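(* Let $\delta>0$ and let $Q$ be a positive random variable with $E(Q)=1$ but with otherwise arbitrary distribution. Consider the homogeneous continuous-time branching process with birth rate $\delta$ and life-length distribution $Q$, let $X(u)$ denote the number of individuals alive at time $u\ge 0$, and assume $X(0)=1$. For a positive integer $K$ let $A_K=\int_0^\infty 1_{\{X(u)=K\}}\,du$. Then for every $K=1,2,\dots$, $$E(A_K)=\int_0^\infty P(X(u)=K)\,du=\frac{\delta^{K-1}}{K\,(1\vee\delta)^K},$$ where $1\vee\delta=\max(1,\delta)$.
   Context: The branching process (a binary splitting tree) is defined as follows. At time $0$ there is one newborn ancestor. Every individual lives for a random time distributed as $Q$; during its life it gives birth to single children at the points of a Poisson process of constant rate $\delta$. All life-lengths and all birth Poisson processes are mutually independent, and each child from its birth behaves in the same way. $A_K$ is the accumulated time during which exactly $K$ individuals are alive. *)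

theory Defs
  imports "HOL-Probability.Probability" "HOL-Library.Extended_Nat"
begin

text \<open>
  Individuals are labelled by Ulam--Harris words, written youngest generation first:
  \<open>[]\<close> is the ancestor and \<open>k # v\<close> is the child belonging to the \<open>k\<close>-th point (\<open>k = 0, 1, \<dots>\<close>)
  of the birth process of \<open>v\<close>. \<open>L v\<close> is the life-length of \<open>v\<close>, and \<open>G v 0, G v 1, \<dots>\<close> are the
  successive gaps of the birth process of \<open>v\<close>, the first gap being measured from the birth of \<open>v\<close>.
  The birth process runs for ever; only its points falling within the life of \<open>v\<close> give children,
  so not every word labels an individual that is actually born.
\<close>

type_synonym individual = "nat list"

definition birth_point ::
  "(individual \<Rightarrow> nat \<Rightarrow> 'a \<Rightarrow> real) \<Rightarrow> individual \<Rightarrow> nat \<Rightarrow> 'a \<Rightarrow> real" where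
  "birth_point G v k \<omega> = (\<Sum>i\<le>k. G v i \<omega>)"

primrec born ::
  "(individual \<Rightarrow> 'a \<Rightarrow> real) \<Rightarrow> (individual \<Rightarrow> nat \<Rightarrow> 'a \<Rightarrow> real) \<Rightarrow> individual \<Rightarrow> 'a \<Rightarrow> bool" where
  "born L G [] \<omega> \<longleftrightarrow> True"
| "born L G (k # v) \<omega> \<longleftrightarrow> born L G v \<omega> \<and> birth_point G v k \<omega> < L v \<omega>"

primrec birth_time ::
  "(individual \<Rightarrow> nat \<Rightarrow> 'a \<Rightarrow> real) \<Rightarrow> individual \<Rightarrow> 'a \<Rightarrow> real" where
  "birth_time G [] \<omega> = 0"
| "birth_time G (k # v) \<omega> = birth_time G v \<omega> + birth_point G v k \<omega>"

definition alive ::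
  "(individual \<Rightarrow> 'a \<Rightarrow> real) \<Rightarrow> (individual \<Rightarrow> nat \<Rightarrow> 'a \<Rightarrow> real) \<Rightarrow> real \<Rightarrow> 'a \<Rightarrow> individual set" where
  "alive L G u \<omega> =
    {v. born L G v \<omega> \<and> birth_time G v \<omega> \<le> u \<and> u < birth_time G v \<omega> + L v \<omega>}"

definition num_alive ::
  "(individual \<Rightarrow> 'a \<Rightarrow> real) \<Rightarrow> (individual \<Rightarrow> nat \<Rightarrow> 'a \<Rightarrow> real) \<Rightarrow> real \<Rightarrow> 'a \<Rightarrow> enat" where
  "num_alive L G u \<omega> =
    (if finite (alive L G u \<omega>) then enat (card (alive L G u \<omega>)) else \<infinity>)"

definition time_at ::
  "(individual \<Rightarrow> 'a \<Rightarrow> real) \<Rightarrow> (individual \<Rightarrow> nat \<Rightarrow> 'a \<Rightarrow> real) \<Rightarrow> nat \<Rightarrow> 'a \<Rightarrow> ennreal" where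
  "time_at L G K \<omega> = (\<integral>\<^sup>+u\<in>{0..}. indicator {u. num_alive L G u \<omega> = enat K} u \<partial>lborel)"

text \<open>
  \<open>\<mu>\<close> is the law of the life-lengths. A Poisson process of rate \<open>\<delta>\<close> is given by independent
  exponential gaps of rate \<open>\<delta>\<close>; hence mutual independence of all life-lengths and all birth
  processes is the same as mutual independence of all life-lengths and all gaps.
\<close>

locale splitting_tree = prob_space M
  for M :: "'a measure" and \<mu> :: "real measure" and \<delta> :: real
    and L :: "individual \<Rightarrow> 'a \<Rightarrow> real" and G :: "individual \<Rightarrow> nat \<Rightarrow> 'a \<Rightarrow> real" +
  assumes life_law: "\<And>v. distr M borel (L v) = \<mu>"
    and gap_law: "\<And>v k. distributed M lborel (G v k) (exponential_density \<delta>)"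
    and independent: "indep_vars (\<lambda>_. borel)
      (\<lambda>i. case i of Inl v \<Rightarrow> L v | Inr (v, k) \<Rightarrow> G v k)
      (UNIV :: (individual + individual \<times> nat) set)"

end

theory Submission
  imports Defs
begin

text \<open>
  Let \<open>F s u\<close> be the expectation of \<open>s ^ X(u)\<close> and \<open>H s t = exp (\<delta> * \<integral>\<^sub>0\<^sup>t (1 - F s))\<close>. Conditioning on
  the life-length \<open>l\<close> of the ancestor and on its birth process gives
  \<open>F s u * H s u = \<integral> (if u < l then s else 1) * H s (u - l) \<mu>(dl)\<close>. As \<open>H' = \<delta> * (1 - F) * H\<close>, this is
  an affine equation for \<open>H\<close>: the function \<open>V = H - 1\<close> satisfies
  \<open>V s t = \<delta> * \<integral>\<^sub>0\<^sup>t (V s (t - y) + 1 - s) * \<mu>(y, \<infinity>) dy\<close>. By uniqueness \<open>V s = (1 - s) * V 0\<close>, that is,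
  \<open>\<delta> * \<integral>\<^sub>0\<^sup>t (1 - F s) = ln (s + (1 - s) * W t)\<close> with \<open>W = V 0 + 1\<close>. The coefficient of \<open>s ^ K\<close> is
  \<open>\<integral>\<^sub>0\<^sup>t P(X(u) = K) du = (1 - 1 / W t) ^ K / (\<delta> * K)\<close>. Finally the renewal equation of \<open>W\<close> and
  \<open>\<integral>\<^sub>0\<^sup>\<infinity> \<mu>(y, \<infinity>) dy = 1\<close> force \<open>1 - 1 / W t\<close> to converge to \<open>min 1 \<delta>\<close>.
\<close>

section \<open>Bounded measurable functions on the line\<close>

text \<open>A priori the population may be infinite, and every parent has infinitely many potential
  children. Taking \<open>s < 1\<close> throughout meets both difficulties: an infinite population
  counts as \<open>s ^ \<infinity> = 0\<close>, and this convention is continuous along increasing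
  unions, so one can truncate to the first \<open>n\<close> potential children and let
  \<open>n\<close> grow. For a parent with life-length \<open>l\<close> the birth process
  contributes \<open>exp (- \<delta> * \<integral>\<^sub>0\<^sup>l (1 - F s (u - y)) dy)\<close>,
  the generating functional of a Poisson process. As the process is given by its gaps, this value
  arises as the limit of an iteration over successive points. Reversing time turns the exponential
  into \<open>H s (u - l) / H s u\<close>; this is the origin of \<open>H\<close>, in which a
  nonlinear equation for \<open>F\<close> becomes affine. Coefficients are compared at a finite
  horizon \<open>t\<close>, where the term of \<open>s ^ 0\<close> is finite, and only then does
  \<open>t\<close> grow. The limit is taken for \<open>1 / W\<close>, which treats bounded and
  unbounded \<open>W\<close> alike.\<close>

lemma bounded_borel_set_integrable:
  fixes f :: "real \<Rightarrow> real"
  assumes "f \<in> borel_measurable borel" and "\<And>x. x \<in> {a..b} \<Longrightarrow> \<bar>f x\<bar> \<le> B"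
  shows "set_integrable lborel {a..b} f"
proof -
  have "integrable lborel (\<lambda>x. indicator {a..b} x * B)"
    by (intro integrable_mult_left integrable_real_indicator) (auto simp: emeasure_lborel_Icc_eq)
  then show ?thesis
    unfolding set_integrable_def
  proof (rule Bochner_Integration.integrable_bound)
    show "AE x in lborel. norm (indicator {a..b} x *\<^sub>R f x) \<le> norm (indicator {a..b} x * B)"
      using order_trans[OF assms(2) abs_ge_self] by (intro AE_I2) (auto simp: indicator_def)
  qed (use assms(1) in measurable)
qed

lemma bounded_borel_integrable_indicator:
  fixes f :: "real \<Rightarrow> real"
  assumes "f \<in> borel_measurable borel" and "\<And>y. y \<in> {a..b} \<Longrightarrow> \<bar>f y\<bar> \<le> B"
  shows "integrable lborel (\<lambda>y. indicator {a..b} y * f y)"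
  using bounded_borel_set_integrable[OF assms] by (simp add: set_integrable_def)

lemma bounded_borel_integrable_on:
  fixes f :: "real \<Rightarrow> real"
  assumes "f \<in> borel_measurable borel" and "\<And>x. x \<in> {a..b} \<Longrightarrow> \<bar>f x\<bar> \<le> B"
  shows "f integrable_on {a..b}"
  by (rule set_borel_integral_eq_integral) (rule bounded_borel_set_integrable[OF assms])

text \<open>Both integrals are used side by side: the gauge integral splits intervals and carries
  the fundamental theorem of calculus, the Lebesgue integral carries substitution, Fubini and
  dominated convergence.\<close>

lemma bounded_borel_integral_eq:
  fixes f :: "real \<Rightarrow> real"
  assumes "f \<in> borel_measurable borel" and "\<And>x. x \<in> {a..b} \<Longrightarrow> \<bar>f x\<bar> \<le> B"
  shows "integral {a..b} f = (\<integral>x. indicator {a..b} x * f x \<partial>lborel)"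
  using set_borel_integral_eq_integral(2)[OF bounded_borel_set_integrable[OF assms]]
  by (simp add: set_lebesgue_integral_def)

lemma integral_abs_le:
  fixes f :: "real \<Rightarrow> real"
  assumes "f integrable_on {a..b}" and "\<And>x. x \<in> {a..b} \<Longrightarrow> \<bar>f x\<bar> \<le> B" and "a \<le> b"
  shows "\<bar>integral {a..b} f\<bar> \<le> B * (b - a)"
  using integral_norm_bound_integral[OF assms(1), of "\<lambda>_. B"] assms(2,3)
  by (simp add: mult.commute integrable_const_ivl)

lemma integral_diff_eq:
  fixes f :: "real \<Rightarrow> real"
  assumes "f integrable_on {a..y}" "a \<le> x" "x \<le> y"
  shows "integral {a..y} f - integral {a..x} f = integral {x..y} f"
  using Henstock_Kurzweil_Integration.integral_combine[OF assms(2,3,1)] by simp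

section \<open>Exponentials of indefinite integrals\<close>

lemma constant_of_quadratic_increments:
  fixes D :: "real \<Rightarrow> real"
  assumes "a \<le> b" and D: "\<And>x y. a \<le> x \<Longrightarrow> x \<le> y \<Longrightarrow> y \<le> b \<Longrightarrow> \<bar>D y - D x\<bar> \<le> K * (y - x)^2"
  shows "D b = D a"
proof -
  have "(D has_field_derivative 0) (at x within {a..b})" if x: "x \<in> {a..b}" for x
  proof -
    have le: "norm ((D y - D x) / (y - x)) \<le> K * \<bar>y - x\<bar>" if "y \<in> {a..b}" "y \<noteq> x" for y
    proof -
      have "\<bar>D y - D x\<bar> \<le> K * \<bar>y - x\<bar>^2"
        using D[of x y] D[of y x] x that
        by (cases "x \<le> y") (auto simp: abs_minus_commute power2_commute)
      then show ?thesis
        using that by (simp add: abs_divide divide_le_eq power2_eq_square mult.assoc)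
    qed
    have "((\<lambda>y. K * \<bar>y - x\<bar>) \<longlongrightarrow> K * \<bar>x - x\<bar>) (at x within {a..b})"
      by (intro tendsto_intros)
    then have lim: "((\<lambda>y. K * \<bar>y - x\<bar>) \<longlongrightarrow> 0) (at x within {a..b})"
      by simp
    have "eventually (\<lambda>y. norm ((D y - D x) / (y - x)) \<le> K * \<bar>y - x\<bar>) (at x within {a..b})"
      unfolding eventually_at_filter using le by simp
    then have "((\<lambda>y. (D y - D x) / (y - x)) \<longlongrightarrow> 0) (at x within {a..b})"
      by (rule Lim_null_comparison[OF _ lim])
    then show ?thesis
      by (simp add: has_field_derivative_iff)
  qed
  then have "\<exists>c. \<forall>x\<in>{a..b}. D x = c"
    by (intro has_field_derivative_zero_constant) auto
  with \<open>a \<le> b\<close> show ?thesis by auto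
qed

lemma indefinite_integral_lipschitz:
  fixes c :: "real \<Rightarrow> real"
  assumes c: "c \<in> borel_measurable borel" and B: "\<And>x. \<bar>c x\<bar> \<le> B"
  shows "\<bar>integral {a..y} c - integral {a..x} c\<bar> \<le> B * \<bar>y - x\<bar>"
proof -
  have int: "c integrable_on {u..v}" for u v
    using bounded_borel_integrable_on[OF c B] .
  have B0: "B \<ge> 0" using B[of 0] by linarith
  have *: "\<bar>integral {a..y} c - integral {a..x} c\<bar> \<le> B * (y - x)" if "x \<le> y" for x y
  proof (cases "a \<le> x")
    case True
    then show ?thesis using that integral_diff_eq[OF int True that] integral_abs_le[OF int B that] by simp
  next
    \<comment> \<open>Left of \<open>a\<close> the interval is empty and its integral is 0, so the
      function is constant there.\<close>
    case F: False
    show ?thesis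
    proof (cases "a \<le> y")
      case True
      have "\<bar>integral {a..y} c\<bar> \<le> B * (y - a)" using integral_abs_le[OF int B True] .
      also have "\<dots> \<le> B * (y - x)" using F B0 by (intro mult_left_mono) auto
      finally show ?thesis using F by simp
    next
      case False
      then show ?thesis using F B0 that by simp
    qed
  qed
  show ?thesis
    using *[of x y] *[of y x] by (cases "x \<le> y") (auto simp: abs_minus_commute)
qed

lemma indefinite_integral_continuous:
  fixes c :: "real \<Rightarrow> real"
  assumes c: "c \<in> borel_measurable borel" and B: "\<And>x. \<bar>c x\<bar> \<le> B"
  shows "continuous_on UNIV (\<lambda>x. integral {a..x} c)"
proof (rule lipschitz_on_continuous_on)
  show "B-lipschitz_on UNIV (\<lambda>x. integral {a..x} c)"
    using indefinite_integral_lipschitz[OF c B] B[of 0]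
    by (intro lipschitz_onI) (auto simp: dist_real_def)
qed

text \<open>
  As \<open>c\<close> is merely measurable, the fundamental theorem of calculus is not available; instead, the
  difference of the two sides has increments of second order and is therefore constant.
\<close>

lemma integral_exp_integral:
  fixes c :: "real \<Rightarrow> real"
  assumes c: "c \<in> borel_measurable borel" and B: "\<And>x. \<bar>c x\<bar> \<le> B" and ab: "a \<le> b"
  shows "integral {a..b} (\<lambda>y. c y * exp (integral {a..y} c)) = exp (integral {a..b} c) - 1"
proof -
  define C where "C y = integral {a..y} c" for y
  have B0: "B \<ge> 0" using B[of 0] by linarith
  have int: "c integrable_on {u..v}" for u v
    using bounded_borel_integrable_on[OF c B] .
  have lip: "\<bar>C y - C x\<bar> \<le> B * \<bar>y - x\<bar>" for x y
    unfolding C_def by (rule indefinite_integral_lipschitz[OF c B])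
  have Cm: "C \<in> borel_measurable borel"
    unfolding C_def by (intro borel_measurable_continuous_onI indefinite_integral_continuous[OF c B])
  define M where "M = exp (B * (b - a))"
  have CM: "exp (C z) \<le> M" if "z \<in> {a..b}" for z
  proof -
    have "C z \<le> B * (z - a)" using lip[of z a] that by (simp add: C_def)
    also have "\<dots> \<le> B * (b - a)" using that B0 by (intro mult_left_mono) auto
    finally show ?thesis by (simp add: M_def)
  qed
  have intC: "(\<lambda>z. c z * exp (C z)) integrable_on {u..v}" if "{u..v} \<subseteq> {a..b}" for u v
    by (rule bounded_borel_integrable_on[where B = "B * M"])
      (use that c Cm CM B B0 in \<open>auto simp: abs_mult intro!: mult_mono\<close>)
  define D where "D y = exp (C y) - integral {a..y} (\<lambda>z. c z * exp (C z))" for y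
  have "D b = D a"
  proof (rule constant_of_quadratic_increments[OF ab])
    fix x y assume xy: "a \<le> x" "x \<le> y" "y \<le> b"
    \<comment> \<open>The mean value theorem is applied to \<open>exp\<close> between
      \<open>C x\<close> and \<open>C y\<close>, not to the composition with \<open>C\<close>, which
      need not be differentiable.\<close>
    obtain \<xi> where \<xi>: "exp (C y) - exp (C x) = (C y - C x) * exp \<xi>"
      and \<xi>b: "min (C x) (C y) \<le> \<xi>" "\<xi> \<le> max (C x) (C y)"
    proof -
      consider "C x < C y" | "C x = C y" | "C y < C x" by linarith
      then show ?thesis
      proof cases
        case 1
        obtain z where "C x < z" "z < C y" "exp (C y) - exp (C x) = (C y - C x) * exp z"
          using MVT2[OF 1, of exp exp] by (auto intro: DERIV_exp)
        then show ?thesis using that[of z] by auto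
      next
        case 2 then show ?thesis using that[of "C x"] by simp
      next
        case 3
        obtain z where "C y < z" "z < C x" "exp (C x) - exp (C y) = (C x - C y) * exp z"
          using MVT2[OF 3, of exp exp] by (auto intro: DERIV_exp)
        then show ?thesis using that[of z] by (auto simp: algebra_simps)
      qed
    qed
    have "\<xi> \<le> B * (b - a)"
    proof -
      have "C x \<le> B * (b - a)" "C y \<le> B * (b - a)"
        using CM[of x] CM[of y] xy by (auto simp: M_def)
      then show ?thesis using \<xi>b by linarith
    qed
    then have eM: "exp \<xi> \<le> M" by (simp add: M_def)
    have "D y - D x = (C y - C x) * exp \<xi> - integral {x..y} (\<lambda>z. c z * exp (C z))"
      using \<xi> integral_diff_eq[OF intC[of a y] xy(1,2)] xy by (simp add: D_def)
    also have "C y - C x = integral {x..y} c"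
      unfolding C_def by (rule integral_diff_eq[OF int xy(1,2)])
    also have "integral {x..y} c * exp \<xi> - integral {x..y} (\<lambda>z. c z * exp (C z))
        = integral {x..y} (\<lambda>z. c z * (exp \<xi> - exp (C z)))"
      using int[of x y] intC[of x y] xy
      by (simp add: right_diff_distrib Henstock_Kurzweil_Integration.integral_diff integrable_on_mult_left)
    finally have *: "D y - D x = integral {x..y} (\<lambda>z. c z * (exp \<xi> - exp (C z)))" .
    \<comment> \<open>One factor \<open>y - x\<close> is the length of the interval; the other is
      the distance of \<open>\<xi>\<close> from \<open>C z\<close>, since \<open>C\<close> is
      Lipschitz and \<open>\<xi>\<close> lies between \<open>C x\<close> and
      \<open>C y\<close>.\<close>
    have "\<bar>integral {x..y} (\<lambda>z. c z * (exp \<xi> - exp (C z)))\<bar> \<le> (B * (M * (2 * B * (y - x)))) * (y - x)"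
    proof (rule integral_abs_le)
      show "(\<lambda>z. c z * (exp \<xi> - exp (C z))) integrable_on {x..y}"
        using int[of x y] intC[of x y] xy
        by (simp add: right_diff_distrib integrable_diff integrable_on_mult_left)
      fix z assume z: "z \<in> {x..y}"
      have exp_lip: "\<bar>exp p - exp q\<bar> \<le> M * \<bar>p - q\<bar>" if "exp p \<le> M" "exp q \<le> M" for p q :: real
      proof -
        \<comment> \<open>The tangent bound \<open>1 + r \<le> exp r\<close> at
          \<open>r = q' - p'\<close>, multiplied by \<open>exp p'\<close>.\<close>
        have 1: "exp p' - exp q' \<le> exp p' * (p' - q')" for p' q' :: real
          using exp_ge_add_one_self[of "q' - p'"] mult_left_mono[of "1 + (q' - p')" "exp (q' - p')" "exp p'"]
          by (simp add: exp_diff algebra_simps)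
        show ?thesis
        proof (cases "p \<le> q")
          case True
          then have "\<bar>exp p - exp q\<bar> \<le> exp q * (q - p)" using 1[of q p] by simp
          also have "\<dots> \<le> M * (q - p)" using that True by (intro mult_right_mono) auto
          finally show ?thesis using True by simp
        next
          case False
          then have "\<bar>exp p - exp q\<bar> \<le> exp p * (p - q)" using 1[of p q] by simp
          also have "\<dots> \<le> M * (p - q)" using that False by (intro mult_right_mono) auto
          finally show ?thesis using False by simp
        qed
      qed
      have "\<bar>C x - C z\<bar> \<le> B * (y - x)" "\<bar>C y - C z\<bar> \<le> B * (y - x)"
      proof -
        have "B * \<bar>x - z\<bar> \<le> B * (y - x)" "B * \<bar>y - z\<bar> \<le> B * (y - x)"
          using z B0 by (auto intro!: mult_left_mono)
        then show "\<bar>C x - C z\<bar> \<le> B * (y - x)" "\<bar>C y - C z\<bar> \<le> B * (y - x)"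
          using lip[of x z] lip[of y z] by auto
      qed
      then have "\<bar>\<xi> - C z\<bar> \<le> 2 * B * (y - x)"
        using \<xi>b by linarith
      then have "M * \<bar>\<xi> - C z\<bar> \<le> M * (2 * B * (y - x))"
        by (intro mult_left_mono) (auto simp: M_def)
      then have "\<bar>exp \<xi> - exp (C z)\<bar> \<le> M * (2 * B * (y - x))"
        using exp_lip[OF eM, of "C z"] CM[of z] z xy by auto
      then show "\<bar>c z * (exp \<xi> - exp (C z))\<bar> \<le> B * (M * (2 * B * (y - x)))"
        unfolding abs_mult using B B0 by (intro mult_mono) auto
    qed (use xy in auto)
    then show "\<bar>D y - D x\<bar> \<le> (2 * B^2 * M) * (y - x)^2"
      unfolding * by (simp add: power2_eq_square algebra_simps)
  qed
  then show ?thesis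
    by (simp add: D_def C_def)
qed

text \<open>Factoring out \<open>exp (integral {a..b} c)\<close> leaves the forward version for
  \<open>- c\<close>. This orientation occurs for the birth process, where the exponent collects the
  points still to come before the death of the parent.\<close>

lemma integral_exp_integral_reflected:
  fixes c :: "real \<Rightarrow> real"
  assumes c: "c \<in> borel_measurable borel" and B: "\<And>x. \<bar>c x\<bar> \<le> B" and ab: "a \<le> b"
  shows "integral {a..b} (\<lambda>y. c y * exp (integral {y..b} c)) = exp (integral {a..b} c) - 1"
proof -
  have int: "c integrable_on {u..v}" for u v
    using bounded_borel_integrable_on[OF c B] .
  have "integral {a..b} (\<lambda>y. c y * exp (integral {y..b} c))
      = integral {a..b} (\<lambda>y. (- exp (integral {a..b} c)) * ((- c y) * exp (integral {a..y} (\<lambda>y. - c y))))"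
  proof (rule Henstock_Kurzweil_Integration.integral_cong)
    fix y assume "y \<in> {a..b}"
    then have "integral {a..b} c = integral {a..y} c + integral {y..b} c"
      using Henstock_Kurzweil_Integration.integral_combine[OF _ _ int, of a y b] by simp
    then show "c y * exp (integral {y..b} c)
        = (- exp (integral {a..b} c)) * ((- c y) * exp (integral {a..y} (\<lambda>y. - c y)))"
      by (simp flip: exp_add)
  qed
  also have "\<dots> = (- exp (integral {a..b} c)) * (exp (integral {a..b} (\<lambda>y. - c y)) - 1)"
    unfolding integral_mult_right
    using integral_exp_integral[of "\<lambda>y. - c y" B a b] c B ab by simp
  also have "\<dots> = exp (integral {a..b} c) - 1"
    by (simp add: algebra_simps flip: exp_add)
  finally show ?thesis .
qed

text \<open>With \<open>f = 1 - F s\<close> and \<open>c = \<delta>\<close> this is the integrated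
  form of \<open>H' = \<delta> * (1 - F s) * H\<close>.\<close>

lemma integral_exp_const_mult:
  fixes f :: "real \<Rightarrow> real"
  assumes f: "f \<in> borel_measurable borel" and B: "\<And>x. \<bar>f x\<bar> \<le> B" and t: "0 \<le> t"
  shows "exp (c * integral {0..t} f) = 1 + c * integral {0..t} (\<lambda>y. f y * exp (c * integral {0..y} f))"
proof -
  have "\<bar>c * f x\<bar> \<le> \<bar>c\<bar> * B" for x using B[of x] by (simp add: abs_mult mult_left_mono)
  from integral_exp_integral[of "\<lambda>y. c * f y", OF _ this t] f
  show ?thesis by (simp add: mult.assoc)
qed

text \<open>Compared with \<open>exp (2 * \<delta> * t)\<close>, each pass through the inequality
  halves the constant, because \<open>\<delta> * \<integral>\<^sub>0\<^sup>t exp (2 * \<delta> * y)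
  dy \<le> exp (2 * \<delta> * t) / 2\<close>. Iteration from the bound \<open>B\<close> leaves
  0.\<close>

lemma gronwall_zero:
  fixes D :: "real \<Rightarrow> real"
  assumes \<delta>: "\<delta> > 0" and D: "D \<in> borel_measurable borel" and B: "\<And>t. t \<in> {0..T} \<Longrightarrow> \<bar>D t\<bar> \<le> B"
    and le: "\<And>t. t \<in> {0..T} \<Longrightarrow> \<bar>D t\<bar> \<le> \<delta> * integral {0..t} (\<lambda>y. \<bar>D y\<bar>)"
    and T: "0 \<le> T"
  shows "D T = 0"
proof -
  have B0: "B \<ge> 0" using B[of 0] T by force
  have *: "\<bar>D t\<bar> \<le> B * (1/2)^n * exp (2 * \<delta> * t)" if "t \<in> {0..T}" for n t
    using that
  proof (induction n arbitrary: t)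
    case 0
    have "B * 1 \<le> B * exp (2 * \<delta> * t)" using 0 \<delta> B0 by (intro mult_left_mono) auto
    then show ?case using B[OF 0] by simp
  next
    case (Suc n)
    have "((\<lambda>y. B * (1/2)^n * exp (2 * \<delta> * y)) has_integral
        (B * (1/2)^n / (2 * \<delta>) * exp (2 * \<delta> * t) - B * (1/2)^n / (2 * \<delta>) * exp (2 * \<delta> * 0))) {0..t}"
      using \<delta> Suc.prems
      by (intro fundamental_theorem_of_calculus)
        (auto intro!: derivative_eq_intros simp flip: has_real_derivative_iff_has_vector_derivative)
    note hi = this
    have "integral {0..t} (\<lambda>y. \<bar>D y\<bar>) \<le> integral {0..t} (\<lambda>y. B * (1/2)^n * exp (2 * \<delta> * y))"
    proof (rule integral_le)
      show "(\<lambda>y. \<bar>D y\<bar>) integrable_on {0..t}"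
        by (rule bounded_borel_integrable_on[where B = B]) (use D B Suc.prems in auto)
      show "(\<lambda>y. B * (1/2)^n * exp (2 * \<delta> * y)) integrable_on {0..t}" using hi by blast
    qed (use Suc in auto)
    also have "\<dots> \<le> B * (1/2)^n / (2 * \<delta>) * exp (2 * \<delta> * t)"
      using integral_unique[OF hi] B0 \<delta> by simp
    finally have "\<delta> * integral {0..t} (\<lambda>y. \<bar>D y\<bar>) \<le> \<delta> * (B * (1/2)^n / (2 * \<delta>) * exp (2 * \<delta> * t))"
      using \<delta> by (intro mult_left_mono) auto
    also have "\<dots> = B * (1/2)^Suc n * exp (2 * \<delta> * t)"
      using \<delta> by (simp add: field_simps)
    finally show ?case using le[OF Suc.prems] by linarith
  qed
  have "(\<lambda>n. B * (1/2)^n * exp (2 * \<delta> * T)) \<longlonglongrightarrow> B * 0 * exp (2 * \<delta> * T)"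
    by (intro tendsto_intros LIMSEQ_power_zero) auto
  then have "\<bar>D T\<bar> \<le> B * 0 * exp (2 * \<delta> * T)"
    by (rule LIMSEQ_le_const) (use * T in auto)
  then show ?thesis by simp
qed

text \<open>Once the coefficients below \<open>n\<close> vanish, division by \<open>s ^ n\<close>
  leaves a power series that is 0 for \<open>0 < s < 1\<close> and continuous at 0, where its value
  is \<open>d n\<close>. Only positive \<open>s\<close> is available, hence the limit from the
  right.\<close>

lemma powser_coeffs_zero:
  fixes d :: "nat \<Rightarrow> real"
  assumes "\<And>s. 0 < s \<Longrightarrow> s < 1 \<Longrightarrow> (\<lambda>n. d n * s^n) sums 0"
  shows "d n = 0"
proof (induction n rule: less_induct)
  case (less n)
  define g where "g x = (\<Sum>k. d (k + n) * x^k)" for x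
  have sm: "(\<lambda>k. d (k + n) * s^k) sums 0" if s: "0 < s" "s < 1" for s
  proof -
    have "(\<lambda>k. d (k + n) * s^(k+n)) sums (0 - (\<Sum>i<n. d i * s^i))"
      using sums_split_initial_segment[OF assms[OF s], of n] by simp
    then have "(\<lambda>k. s^n * (d (k + n) * s^k)) sums 0"
      using less by (simp add: power_add mult_ac)
    then have "(\<lambda>k. (1 / s^n) * (s^n * (d (k + n) * s^k))) sums ((1/s^n) * 0)"
      by (rule sums_mult)
    then show ?thesis using s by simp
  qed
  have "(g \<longlongrightarrow> d (0 + n)) (at 0)"
  proof (rule powser_limit_0[where s = "1/2" and a = "\<lambda>k. d (k + n)"])
    fix x :: real assume "norm x < 1/2"
    then have "summable (\<lambda>k. d (k + n) * x^k)"
      using powser_inside[of "\<lambda>k. d (k + n)" "1/2" x] sm[of "1/2"] by (auto dest: sums_summable)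
    then show "(\<lambda>k. d (k + n) * x^k) sums g x" unfolding g_def by (rule summable_sums)
  qed auto
  then have "(g \<longlongrightarrow> d n) (at_right 0)"
    by (simp add: filterlim_at_split)
  moreover have "eventually (\<lambda>x. g x = 0) (at_right 0)"
    unfolding eventually_at_right_field
    by (rule exI[of _ 1]) (use sm in \<open>auto simp: g_def sums_iff\<close>)
  then have "(g \<longlongrightarrow> 0) (at_right 0)" by (rule tendsto_eventually)
  ultimately show ?case by (intro tendsto_unique[OF trivial_limit_at_right_real])
qed

lemma abs_mult_le_1: "\<bar>x * y\<bar> \<le> 1" if "0 \<le> x" "x \<le> 1" "0 \<le> y" "y \<le> 1" for x y :: real
  using that mult_mono[of x 1 y 1] by simp

text \<open>Rests on \<open>min 1 \<delta> = \<delta> / max 1 \<delta>\<close>; it translates the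
  limit of the occupation times into the closed form of the theorem.\<close>

lemma min_one_divide: "0 < (\<delta>::real) \<Longrightarrow> 1 \<le> K \<Longrightarrow> (min 1 \<delta>) ^ K / (\<delta> * real K) = \<delta> ^ (K - 1) / (real K * max 1 \<delta> ^ K)"
proof -
  assume \<delta>: "0 < \<delta>" and K: "1 \<le> K"
  then have "\<delta> ^ K = \<delta> * \<delta> ^ (K - 1)" "0 < real K"
    by (auto simp: power_eq_if)
  then show ?thesis
    using \<delta> by (cases "\<delta> \<le> 1") (auto simp: field_simps)
qed

section \<open>The population and its decomposition at the ancestor\<close>

text \<open>The value 0 on infinite sets is the convention \<open>s ^ \<infinity> = 0\<close> for
  \<open>0 \<le> s < 1\<close>; it admits an exploding population into the generating
  function.\<close>

definition weight :: "real \<Rightarrow> 'i set \<Rightarrow> real" where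
  "weight s A = (if finite A then s ^ card A else 0)"

lemma weight_nonneg: "0 \<le> s \<Longrightarrow> 0 \<le> weight s A"
  and weight_le_1: "0 \<le> s \<Longrightarrow> s \<le> 1 \<Longrightarrow> weight s A \<le> 1"
  by (auto simp: weight_def power_le_one)

lemma weight_empty [simp]: "weight s {} = 1"
  by (simp add: weight_def)

lemma weight_image: "inj_on f A \<Longrightarrow> weight s (f ` A) = weight s A"
  by (simp add: weight_def card_image finite_image_iff)

lemma weight_Un: "A \<inter> B = {} \<Longrightarrow> weight s (A \<union> B) = weight s A * weight s B"
  by (auto simp: weight_def card_Un_disjoint power_add)

lemma weight_UN_lessThan:
  fixes B :: "nat \<Rightarrow> 'i set"
  assumes "disjoint_family B"
  shows "weight s (\<Union>k<n. B k) = (\<Prod>k<n. weight s (B k))"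
proof (induction n)
  case (Suc n)
  have "B k \<inter> B n = {}" if "k < n" for k
    using disjoint_family_onD[OF assms, of k n] that by simp
  then have "(\<Union>k<n. B k) \<inter> B n = {}"
    by blast
  then show ?case
    using Suc by (simp add: lessThan_Suc Un_commute weight_Un Int_commute mult.commute)
qed simp

text \<open>Here \<open>s < 1\<close> is essential: if the union is infinite, the cardinalities
  eventually exceed every \<open>m\<close> and the weights fall below \<open>s ^ m\<close>. At
  \<open>s = 1\<close> an increasing union of finite sets could jump from 1 to 0.\<close>

lemma weight_incseq_tendsto:
  fixes C :: "nat \<Rightarrow> 'i set"
  assumes C: "incseq C" and s: "0 \<le> s" "s < 1"
  shows "(\<lambda>n. weight s (C n)) \<longlonglongrightarrow> weight s (\<Union>n. C n)"
proof -
  have sub: "\<exists>N. \<forall>n\<ge>N. S \<subseteq> C n" if "finite S" "S \<subseteq> (\<Union>n. C n)" for S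
    using that
  proof (induction S)
    case (insert x S)
    then obtain N where N: "\<forall>n\<ge>N. S \<subseteq> C n" by auto
    from insert obtain m where "x \<in> C m" by auto
    then have "\<forall>n\<ge>m. x \<in> C n" using C by (auto simp: incseq_def)
    with N show ?case by (intro exI[of _ "max N m"]) auto
  qed simp
  show ?thesis
  proof (cases "finite (\<Union>n. C n)")
    case True
    from sub[OF this] obtain N where "\<forall>n\<ge>N. (\<Union>n. C n) \<subseteq> C n" by blast
    then have "C n = (\<Union>n. C n)" if "n \<ge> N" for n using that by blast
    then have "eventually (\<lambda>n. weight s (C n) = weight s (\<Union>n. C n)) sequentially"
      by (intro eventually_sequentiallyI[of N]) simp
    then show ?thesis by (rule tendsto_eventually)
  next
    case False
    have "weight s (\<Union>n. C n) = 0" using False by (simp add: weight_def)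
    moreover have "(\<lambda>n. weight s (C n)) \<longlonglongrightarrow> 0"
    proof (rule LIMSEQ_I)
      fix r :: real assume "r > 0"
      then obtain m where m: "s ^ m < r" using real_arch_pow_inv[of r s] s by auto
      obtain S where S: "S \<subseteq> (\<Union>n. C n)" "finite S" "card S = m"
        using infinite_arbitrarily_large[OF False, of m] by blast
      from sub[OF S(2,1)] obtain N where N: "\<forall>n\<ge>N. S \<subseteq> C n" by auto
      have "norm (weight s (C n) - 0) < r" if "n \<ge> N" for n
      proof (cases "finite (C n)")
        case True
        have "m \<le> card (C n)" using card_mono[OF True, of S] N that S by auto
        then have "s ^ card (C n) \<le> s ^ m" using s by (intro power_decreasing) auto
        then show ?thesis using m s True by (simp add: weight_def)
      qed (use \<open>r > 0\<close> in \<open>simp add: weight_def\<close>)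
      then show "\<exists>no. \<forall>n\<ge>no. norm (weight s (C n) - 0) < r" by blast
    qed
    ultimately show ?thesis by simp
  qed
qed

lemma weight_sums:
  assumes s: "0 \<le> s"
  shows "(\<Sum>k. ennreal (s ^ k) * indicator {A. finite A \<and> card A = k} A) = ennreal (weight s A)"
proof -
  have "(\<lambda>k. ennreal (s ^ k) * indicator {A. finite A \<and> card A = k} A)
      sums (\<Sum>k\<in>{card A}. ennreal (s ^ k) * indicator {A. finite A \<and> card A = k} A)"
    by (rule sums_finite) (auto simp: indicator_def)
  then show ?thesis
    by (auto simp: sums_iff weight_def indicator_def)
qed

text \<open>A point of the canonical space: one real number for every life-length and every gap. On
  this space the descendants of a child again form a configuration, obtained by reindexing.\<close>

type_synonym config = "individual + individual \<times> nat \<Rightarrow> real"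

abbreviation life :: "individual \<Rightarrow> config \<Rightarrow> real" where
  "life v x \<equiv> x (Inl v)"

abbreviation gap :: "individual \<Rightarrow> nat \<Rightarrow> config \<Rightarrow> real" where
  "gap v k x \<equiv> x (Inr (v, k))"

abbreviation pop :: "real \<Rightarrow> config \<Rightarrow> individual set" where
  "pop \<equiv> alive life gap"

text \<open>Index of a variable of the subtree founded by the \<open>k\<close>-th child of the ancestor.\<close>

definition sub_index :: "nat \<Rightarrow> individual + individual \<times> nat \<Rightarrow> individual + individual \<times> nat" where
  "sub_index k = map_sum (\<lambda>w. w @ [k]) (map_prod (\<lambda>w. w @ [k]) id)"

definition subtree :: "nat \<Rightarrow> config \<Rightarrow> config" where
  "subtree k x = (\<lambda>i. x (sub_index k i))"

lemma inj_sub_index: "inj (sub_index k)"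
  unfolding sub_index_def by (intro sum.inj_map prod.inj_map) (auto simp: inj_def)

lemma sub_index_eqD: "sub_index k i = sub_index l j \<Longrightarrow> k = l"
  unfolding sub_index_def by (cases i; cases j) auto

lemma sub_index_neq [simp]:
  "sub_index k i \<noteq> Inl []" "sub_index k i \<noteq> Inr ([], j)"
  unfolding sub_index_def by (cases i; auto)+

lemma birth_point_subtree: "birth_point gap v j (subtree k x) = birth_point gap (v @ [k]) j x"
  by (simp add: birth_point_def subtree_def sub_index_def)

text \<open>Words carry the youngest generation in front, so the child of the ancestor from which an
  individual descends is the last letter, at the end opposite to the one where \<open>born\<close>
  recurses.\<close>

lemma born_snoc:
  "born life gap (w @ [k]) x \<longleftrightarrow> birth_point gap [] k x < life [] x \<and> born life gap w (subtree k x)"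
  by (induction w) (auto simp: birth_point_subtree, auto simp: subtree_def sub_index_def)

lemma birth_time_snoc:
  "birth_time gap (w @ [k]) x = birth_point gap [] k x + birth_time gap w (subtree k x)"
  by (induction w) (auto simp: birth_point_subtree)

text \<open>Words are sorted by their last letter. The identity is pointwise and covers
  configurations with negative gaps as well.\<close>

lemma pop_decompose:
  "pop u x = (if 0 \<le> u \<and> u < life [] x then {[]} else {}) \<union>
    (\<Union>k. if birth_point gap [] k x < life [] x
       then (\<lambda>w. w @ [k]) ` pop (u - birth_point gap [] k x) (subtree k x) else {})"
    (is "_ = ?R")
proof -
  have "v \<in> pop u x \<longleftrightarrow> v \<in> ?R" for v
  proof (cases v rule: rev_cases)
    case Nil
    then show ?thesis by (auto simp: alive_def split: if_splits)
  next
    case (snoc w k)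
    have "life (w @ [k]) x = life w (subtree k x)"
      by (simp add: subtree_def sub_index_def)
    then show ?thesis
      unfolding snoc by (auto simp: alive_def born_snoc birth_time_snoc split: if_splits)
  qed
  then show ?thesis by blast
qed

text \<open>The first \<open>n\<close> potential children give an increasing union of disjoint
  pieces, to which the continuity of \<open>weight\<close> applies; points after the death of the
  ancestor contribute the factor 1. Finite products are what the later recursion over the children
  can handle.\<close>

lemma weight_pop_tendsto:
  assumes s: "0 \<le> s" "s < 1" and u: "0 \<le> u"
  shows "(\<lambda>n. (if u < life [] x then s else 1) *
      (\<Prod>k<n. if birth_point gap [] k x < life [] x
         then weight s (pop (u - birth_point gap [] k x) (subtree k x)) else 1))
    \<longlonglongrightarrow> weight s (pop u x)"
proof -
  define B where "B k = (if birth_point gap [] k x < life [] x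
    then (\<lambda>w. w @ [k]) ` pop (u - birth_point gap [] k x) (subtree k x) else {})" for k
  define R where "R = (if u < life [] x then {[] :: individual} else {})"
  have "disjoint_family B"
    by (auto simp: disjoint_family_on_def B_def)
  moreover have "R \<inter> (\<Union>k<n. B k) = {}" for n
    by (auto simp: R_def B_def split: if_splits)
  ultimately have "weight s (R \<union> (\<Union>k<n. B k)) = weight s R * (\<Prod>k<n. weight s (B k))" for n
    by (simp add: weight_Un weight_UN_lessThan)
  moreover have "weight s R = (if u < life [] x then s else 1)"
    by (simp add: R_def weight_def)
  moreover have "weight s (B k) = (if birth_point gap [] k x < life [] x
      then weight s (pop (u - birth_point gap [] k x) (subtree k x)) else 1)" for k
    by (auto simp: B_def intro!: weight_image inj_onI)
  moreover have "(\<lambda>n. weight s (R \<union> (\<Union>k<n. B k))) \<longlonglongrightarrow> weight s (\<Union>n. R \<union> (\<Union>k<n. B k))"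
    by (intro weight_incseq_tendsto s) (force simp: incseq_def)
  moreover have "(\<Union>n. R \<union> (\<Union>k<n. B k)) = pop u x"
    unfolding pop_decompose[of u x] using u by (auto simp: R_def B_def)
  ultimately show ?thesis by simp
qed

text \<open>Negative gaps would allow births before time 0. Excluding them yields
  \<open>F s u = 1\<close> for \<open>u < 0\<close>, the boundary value behind the extension of
  \<open>H\<close> to negative times.\<close>

lemma pop_empty:
  assumes "\<And>i. 0 \<le> x (Inr i)" and "u < 0"
  shows "pop u x = {}"
proof -
  have "0 \<le> birth_time gap v x" for v
    by (induction v) (auto simp: birth_point_def sum_nonneg assms(1))
  then have "\<not> birth_time gap v x \<le> u" for v
    using order_trans[of 0 "birth_time gap v x" u] assms(2) by auto
  then show ?thesis
    by (simp add: alive_def)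
qed

section \<open>Measurability on the space of configurations\<close>

abbreviation config_space :: "config measure" where
  "config_space \<equiv> PiM UNIV (\<lambda>_. borel)"

lemma measurable_birth_point [measurable]:
  "birth_point gap v k \<in> borel_measurable config_space"
  unfolding birth_point_def by measurable

lemma measurable_birth_time [measurable]:
  "birth_time gap v \<in> borel_measurable config_space"
  by (induction v) auto

lemma measurable_born [measurable]:
  "Measurable.pred config_space (born life gap v)"
  by (induction v) auto

lemma measurable_mem_pop [measurable]:
  "Measurable.pred (borel \<Otimes>\<^sub>M config_space) (\<lambda>z. v \<in> pop (fst z) (snd z))"
  unfolding alive_def by measurable

text \<open>\<open>enat\<close> is countable, so each value can be treated separately. A population
  of size \<open>k\<close> is a countable union over the sets of words with \<open>k\<close>
  elements, and infinity is the complement of all these events.\<close>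

lemma measurable_num_alive [measurable]:
  "(\<lambda>z. num_alive life gap (fst z) (snd z)) \<in> measurable (borel \<Otimes>\<^sub>M config_space) (count_space UNIV)"
proof -
  let ?B = "borel \<Otimes>\<^sub>M config_space"
  have *: "Measurable.pred ?B (\<lambda>z. num_alive life gap (fst z) (snd z) = enat k)" for k
  proof -
    have "countable {S :: individual set. finite S \<and> card S = k}"
      by (rule countable_subset[OF _ countable_Collect_finite]) auto
    then have "Measurable.pred ?B
        (\<lambda>z. \<exists>S\<in>{S. finite S \<and> card S = k}. \<forall>v. v \<in> pop (fst z) (snd z) \<longleftrightarrow> v \<in> S)"
      by measurable
    moreover have "(\<exists>S\<in>{S. finite S \<and> card S = k}. \<forall>v. v \<in> pop u x \<longleftrightarrow> v \<in> S)
        \<longleftrightarrow> num_alive life gap u x = enat k" for u x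
      by (auto simp: num_alive_def set_eq_iff[symmetric])
    ultimately show ?thesis by simp
  qed
  have pred_eq: "Measurable.pred ?B (\<lambda>z. num_alive life gap (fst z) (snd z) = e)" for e
  proof (cases e)
    case infinity
    have "Measurable.pred ?B (\<lambda>z. \<not> (\<exists>k. num_alive life gap (fst z) (snd z) = enat k))"
      using * by measurable
    then show ?thesis using infinity by simp
  qed (use * in simp)
  have "(\<lambda>z. num_alive life gap (fst z) (snd z)) -` {e} \<inter> space ?B \<in> sets ?B" for e
    using predE[OF pred_eq[of e]] by (simp add: vimage_def Int_def conj_commute)
  then show ?thesis
    unfolding measurable_count_space_eq2_countable by auto
qed

lemma weight_pop_eq:
  "weight s (pop u x) = (case num_alive life gap u x of enat k \<Rightarrow> s ^ k | \<infinity> \<Rightarrow> 0)"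
  by (auto simp: weight_def num_alive_def)

lemma measurable_weight_pop [measurable]:
  "(\<lambda>z. weight s (pop (fst z) (snd z))) \<in> borel_measurable (borel \<Otimes>\<^sub>M config_space)"
  unfolding weight_pop_eq by measurable

lemma measurable_subtree [measurable]: "subtree k \<in> measurable config_space config_space"
  unfolding subtree_def by (intro measurable_PiM_single') auto

section \<open>Functionals of the points of a Poisson process\<close>

abbreviation exp_law :: "real \<Rightarrow> real measure" where
  "exp_law \<delta> \<equiv> density lborel (exponential_density \<delta>)"

text \<open>\<open>t + y\<close> is the first point of the process after \<open>t\<close>. The
  support condition confines the integral to a compact interval, where the lemmas on bounded
  functions apply.\<close>

lemma integral_exp_law_shift:
  fixes \<phi> :: "real \<Rightarrow> real"
  assumes \<delta>: "\<delta> > 0" and \<phi>[measurable]: "\<phi> \<in> borel_measurable borel" and B: "\<And>z. \<bar>\<phi> z\<bar> \<le> B"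
    and zero: "\<And>z. l < z \<Longrightarrow> \<phi> z = 0"
  shows "(\<integral>y. \<phi> (t + y) \<partial>exp_law \<delta>) = integral {t..l} (\<lambda>z. \<delta> * exp (- \<delta> * (z - t)) * \<phi> z)"
proof -
  have B0: "0 \<le> B" using B[of 0] by linarith
  have "(\<integral>y. \<phi> (t + y) \<partial>exp_law \<delta>) = (\<integral>y. exponential_density \<delta> y * \<phi> (t + y) \<partial>lborel)"
    using \<delta> by (subst integral_density) (auto simp: exponential_density_nonneg)
  also have "\<dots> = (\<integral>z. exponential_density \<delta> (z - t) * \<phi> z \<partial>lborel)"
    by (subst lborel_integral_real_affine[of 1 _ "t"]) (auto simp: algebra_simps)
  also have "\<dots> = (\<integral>z. indicator {t..l} z * (\<delta> * exp (- \<delta> * (z - t)) * \<phi> z) \<partial>lborel)"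
    by (intro Bochner_Integration.integral_cong)
      (auto simp: exponential_density_def indicator_def zero algebra_simps)
  also have "\<dots> = integral {t..l} (\<lambda>z. \<delta> * exp (- \<delta> * (z - t)) * \<phi> z)"
  proof (rule bounded_borel_integral_eq[symmetric])
    fix z assume "z \<in> {t..l}"
    then have "\<delta> * exp (- \<delta> * (z - t)) * \<bar>\<phi> z\<bar> \<le> \<delta> * 1 * B"
      using \<delta> B B0 by (intro mult_mono) auto
    then show "\<bar>\<delta> * exp (- \<delta> * (z - t)) * \<phi> z\<bar> \<le> \<delta> * B"
      using \<delta> by (simp add: abs_mult)
  qed measurable
  finally show ?thesis .
qed

lemma integral_exp_density:
  assumes "t \<le> (l::real)"
  shows "integral {t..l} (\<lambda>z. \<delta> * exp (- \<delta> * (z - t))) = 1 - exp (- \<delta> * (l - t))"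
proof -
  have "((\<lambda>z. \<delta> * exp (- \<delta> * (z - t))) has_integral
      (- exp (- \<delta> * (l - t)) - (- exp (- \<delta> * (t - t))))) {t..l}"
    using assms by (intro fundamental_theorem_of_calculus)
      (auto intro!: derivative_eq_intros simp flip: has_real_derivative_iff_has_vector_derivative)
  then show ?thesis by (auto dest: integral_unique)
qed

text \<open>\<open>\<alpha> t\<close> is the expected product of \<open>h\<close> over the points
  after \<open>t\<close> of a Poisson process of rate \<open>\<delta>\<close>. Conditioning on the
  first of these points suggests the last equation, which is verified here directly on the
  formula.\<close>

lemma poisson_fixed_point:
  fixes h :: "real \<Rightarrow> real"
  assumes \<delta>: "\<delta> > 0" and h[measurable]: "h \<in> borel_measurable borel"
    and h01: "\<And>t. 0 \<le> h t" "\<And>t. h t \<le> 1" and hl: "\<And>t. l \<le> t \<Longrightarrow> h t = 1"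
  defines "\<alpha> \<equiv> \<lambda>t. exp (- \<delta> * integral {t..l} (\<lambda>y. 1 - h y))"
  shows "\<alpha> \<in> borel_measurable borel" and "0 \<le> \<alpha> t" and "\<alpha> t \<le> 1" and "l \<le> t \<Longrightarrow> \<alpha> t = 1"
    and "(\<integral>y. h (t + y) * \<alpha> (t + y) \<partial>exp_law \<delta>) = \<alpha> t"
proof -
  have int: "h integrable_on {u..v}" for u v
    using h h01 by (intro bounded_borel_integrable_on[where B = 1]) auto
  have int1: "(\<lambda>y. 1 - h y) integrable_on {u..v}" for u v
    using h01 by (intro bounded_borel_integrable_on[where B = 1]) auto
  have anti: "integral {t..l} (\<lambda>y. 1 - h y) = integral {t'..l} (\<lambda>y. 1 - h y) + integral {t..t'} (\<lambda>y. 1 - h y)"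
    if "t \<le> t'" "t' \<le> l" for t t'
    using Henstock_Kurzweil_Integration.integral_combine[OF that int1] by simp
  \<comment> \<open>Monotonicity of the exponent yields the measurability of
    \<open>\<alpha>\<close>.\<close>
  have "mono (\<lambda>t. - integral {t..l} (\<lambda>y. 1 - h y))"
  proof (rule monoI)
    fix t t' :: real assume "t \<le> t'"
    show "- integral {t..l} (\<lambda>y. 1 - h y) \<le> - integral {t'..l} (\<lambda>y. 1 - h y)"
    proof (cases "t' \<le> l")
      case True
      have "0 \<le> integral {t..t'} (\<lambda>y. 1 - h y)"
        by (intro integral_nonneg int1) (use h01 in auto)
      then show ?thesis using anti[OF \<open>t \<le> t'\<close> True] by simp
    next
      case False
      have "0 \<le> integral {t..l} (\<lambda>y. 1 - h y)"
        by (intro integral_nonneg int1) (use h01 in auto)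
      then show ?thesis using False by simp
    qed
  qed
  from borel_measurable_mono[OF this] show am[measurable]: "\<alpha> \<in> borel_measurable borel"
    unfolding \<alpha>_def by (auto simp: borel_measurable_uminus_eq)
  show a0: "0 \<le> \<alpha> t" for t by (simp add: \<alpha>_def)
  show a1: "\<alpha> t \<le> 1" for t
    unfolding \<alpha>_def using \<delta> h01 by (simp add: integral_nonneg int1)
  show al: "\<alpha> t = 1" if "l \<le> t" for t
    using that by (cases "t = l") (auto simp: \<alpha>_def)
  interpret E: prob_space "exp_law \<delta>" by (rule prob_space_exponential_density[OF \<delta>])
  have [simp]: "measure (exp_law \<delta>) UNIV = 1" using E.prob_space by simp
  have ha: "\<bar>1 - h z * \<alpha> z\<bar> \<le> 1" for z
    using h01[of z] a0[of z] a1[of z] mult_mono[of "h z" 1 "\<alpha> z" 1] by simp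
  \<comment> \<open>Separates the part without \<open>h\<close>, which merges with the exponential
    density into a factor independent of \<open>z\<close>.\<close>
  have \<alpha>_eq: "\<alpha> z = exp (- \<delta> * (l - z)) * exp (integral {z..l} (\<lambda>y. \<delta> * h y))" if "z \<le> l" for z
  proof -
    have eq: "integral {z..l} (\<lambda>y. 1 - h y) = (l - z) - integral {z..l} h"
      using that int by (subst Henstock_Kurzweil_Integration.integral_diff) auto
    show ?thesis
      unfolding \<alpha>_def eq integral_mult_right mult_exp_exp by (simp add: algebra_simps)
  qed
  show "(\<integral>y. h (t + y) * \<alpha> (t + y) \<partial>exp_law \<delta>) = \<alpha> t"
  proof (cases "t \<le> l")
    case t: True
    have intE: "integrable (exp_law \<delta>) (\<lambda>y. 1 - h (t + y) * \<alpha> (t + y))"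
      by (rule E.integrable_const_bound[where B = 1]) (use ha in auto)
    \<comment> \<open>Passing to the complement is what gives bounded support:
      \<open>h * \<alpha>\<close> is 1 beyond \<open>l\<close>, so \<open>1 - h * \<alpha>\<close>
      vanishes there.\<close>
    have "(\<integral>y. h (t + y) * \<alpha> (t + y) \<partial>exp_law \<delta>) = (\<integral>y. 1 - (1 - h (t + y) * \<alpha> (t + y)) \<partial>exp_law \<delta>)"
      by simp
    also have "\<dots> = 1 - (\<integral>y. 1 - h (t + y) * \<alpha> (t + y) \<partial>exp_law \<delta>)"
      using intE by (subst Bochner_Integration.integral_diff) auto
    also have "(\<integral>y. 1 - h (t + y) * \<alpha> (t + y) \<partial>exp_law \<delta>)
        = integral {t..l} (\<lambda>z. \<delta> * exp (- \<delta> * (z - t)) * (1 - h z * \<alpha> z))"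
      by (rule integral_exp_law_shift[OF \<delta>, of "\<lambda>z. 1 - h z * \<alpha> z" 1]) (use ha hl al in auto)
    also have "\<dots> = integral {t..l} (\<lambda>z. \<delta> * exp (- \<delta> * (z - t))
        - exp (- \<delta> * (l - t)) * ((\<delta> * h z) * exp (integral {z..l} (\<lambda>y. \<delta> * h y))))"
    proof (rule Henstock_Kurzweil_Integration.integral_cong)
      fix z assume z: "z \<in> {t..l}"
      have "exp (- \<delta> * (z - t)) * exp (- \<delta> * (l - z)) = exp (- \<delta> * (l - t))"
        unfolding mult_exp_exp by (simp add: algebra_simps)
      then have "exp (- \<delta> * (z - t)) * \<alpha> z = exp (- \<delta> * (l - t)) * exp (integral {z..l} (\<lambda>y. \<delta> * h y))"
        using z \<alpha>_eq[of z] by (simp flip: mult.assoc)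
      then show "\<delta> * exp (- \<delta> * (z - t)) * (1 - h z * \<alpha> z) = \<delta> * exp (- \<delta> * (z - t))
        - exp (- \<delta> * (l - t)) * ((\<delta> * h z) * exp (integral {z..l} (\<lambda>y. \<delta> * h y)))"
        by (simp add: algebra_simps)
    qed
    also have "\<dots> = (1 - exp (- \<delta> * (l - t)))
        - exp (- \<delta> * (l - t)) * (exp (integral {t..l} (\<lambda>y. \<delta> * h y)) - 1)"
    proof (subst Henstock_Kurzweil_Integration.integral_diff)
      have b: "\<bar>\<delta> * h x\<bar> \<le> \<delta>" for x using \<delta> h01[of x] by (simp add: abs_mult mult_left_le)
      have eq: "(\<delta> * h z) * exp (integral {z..l} (\<lambda>y. \<delta> * h y)) = 
          (\<delta> * h z) * (exp (\<delta> * (l - z)) * \<alpha> z)" if "z \<in> {t..l}" for z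
      proof -
        have "exp (\<delta> * (l - z)) * exp (- \<delta> * (l - z)) = 1"
          unfolding mult_exp_exp by simp
        then have "exp (\<delta> * (l - z)) * \<alpha> z = exp (integral {z..l} (\<lambda>y. \<delta> * h y))"
          using \<alpha>_eq[of z] that by (simp flip: mult.assoc)
        then show ?thesis by simp
      qed
      show "(\<lambda>z. \<delta> * exp (- \<delta> * (z - t))) integrable_on {t..l}"
        by (intro integrable_continuous_interval continuous_intros)
      have "(\<lambda>z. (\<delta> * h z) * (exp (\<delta> * (l - z)) * \<alpha> z)) integrable_on {t..l}"
      proof (rule bounded_borel_integrable_on)
        fix z assume "z \<in> {t..l}"
        then show "\<bar>(\<delta> * h z) * (exp (\<delta> * (l - z)) * \<alpha> z)\<bar> \<le> \<delta> * (exp (\<delta> * (l - t)) * 1)"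
          unfolding abs_mult using b[of z] a0[of z] a1[of z] \<delta> 
          by (intro mult_mono) (auto simp: abs_mult)
      qed measurable
      then have "(\<lambda>z. (\<delta> * h z) * exp (integral {z..l} (\<lambda>y. \<delta> * h y))) integrable_on {t..l}"
        by (rule integrable_eq) (rule eq[symmetric])
      then show "(\<lambda>z. exp (- \<delta> * (l - t)) * ((\<delta> * h z) * exp (integral {z..l} (\<lambda>y. \<delta> * h y)))) integrable_on {t..l}"
        by (rule integrable_on_mult_right)
      have "integral {t..l} (\<lambda>y. (\<delta> * h y) * exp (integral {y..l} (\<lambda>y. \<delta> * h y)))
          = exp (integral {t..l} (\<lambda>y. \<delta> * h y)) - 1"
        by (rule integral_exp_integral_reflected[OF _ b t]) measurable
      then show "integral {t..l} (\<lambda>z. \<delta> * exp (- \<delta> * (z - t))) -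
        integral {t..l} (\<lambda>z. exp (- \<delta> * (l - t)) * ((\<delta> * h z) * exp (integral {z..l} (\<lambda>y. \<delta> * h y))))
        = (1 - exp (- \<delta> * (l - t))) - exp (- \<delta> * (l - t)) * (exp (integral {t..l} (\<lambda>y. \<delta> * h y)) - 1)"
        using integral_exp_density[OF t, of \<delta>] by simp
    qed
    also have "1 - ((1 - exp (- \<delta> * (l - t)))
        - exp (- \<delta> * (l - t)) * (exp (integral {t..l} (\<lambda>y. \<delta> * h y)) - 1))
        = exp (- \<delta> * (l - t)) * exp (integral {t..l} (\<lambda>y. \<delta> * h y))"
      by (simp add: algebra_simps)
    also have "\<dots> = \<alpha> t"
      using \<alpha>_eq[OF t] by simp
    finally show ?thesis .
  next
    case False
    \<comment> \<open>From a start after \<open>l\<close> all further points lie beyond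
      \<open>l\<close>, where \<open>h\<close> and \<open>\<alpha>\<close> are 1.\<close>
    have "AE y in exp_law \<delta>. 0 \<le> y"
      by (auto simp: AE_density exponential_density_def)
    then have "(\<integral>y. h (t + y) * \<alpha> (t + y) \<partial>exp_law \<delta>) = (\<integral>y. 1 \<partial>exp_law \<delta>)"
      using False by (intro integral_cong_AE) (auto simp: hl al)
    then show ?thesis using False al by simp
  qed
qed

text \<open>
  The operator \<open>a \<mapsto> (\<lambda>t. \<integral>y. h (t + y) * a (t + y) \<partial>exp_law \<delta>)\<close> contracts functions supported
  on \<open>[0, l]\<close> by the factor \<open>1 - exp (- \<delta> * l)\<close>, the probability of a point before \<open>l\<close>.
\<close>

lemma poisson_iteration_tendsto:
  fixes h :: "real \<Rightarrow> real"
  assumes \<delta>: "\<delta> > 0" and h[measurable]: "h \<in> borel_measurable borel"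
    and h01: "\<And>t. 0 \<le> h t" "\<And>t. h t \<le> 1" and hl: "\<And>t. l \<le> t \<Longrightarrow> h t = 1"
    and a[measurable]: "\<And>n. a n \<in> borel_measurable borel" and a01: "\<And>n t. 0 \<le> a n t" "\<And>n t. a n t \<le> 1"
    and a0: "\<And>t. a 0 t = 1"
    and aSuc: "\<And>n t. a (Suc n) t = (\<integral>y. h (t + y) * a n (t + y) \<partial>exp_law \<delta>)"
  shows "(\<lambda>n. a n 0) \<longlonglongrightarrow> exp (- \<delta> * integral {0..l} (\<lambda>y. 1 - h y))"
proof -
  define \<alpha> where "\<alpha> t = exp (- \<delta> * integral {t..l} (\<lambda>y. 1 - h y))" for t
  note fp = poisson_fixed_point[where l = l, OF \<delta> h h01 hl, folded \<alpha>_def]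
  have [measurable]: "\<alpha> \<in> borel_measurable borel" by (rule fp(1))
  have \<alpha>01: "0 \<le> \<alpha> t" "\<alpha> t \<le> 1" for t using fp(2,3) by auto
  interpret E: prob_space "exp_law \<delta>" by (rule prob_space_exponential_density[OF \<delta>])
  have [simp]: "measure (exp_law \<delta>) UNIV = 1" using E.prob_space by simp
  have pos: "AE y in exp_law \<delta>. 0 \<le> y"
    by (auto simp: AE_density exponential_density_def)
  \<comment> \<open>Bounds the probability of a next point before \<open>l\<close> for every start
    \<open>t \<ge> 0\<close>, which is why the estimate below is restricted to such
    \<open>t\<close>. The maximum keeps \<open>q\<close> in \<open>[0, 1)\<close> when
    \<open>l\<close> is negative.\<close>
  define q where "q = 1 - exp (- \<delta> * max l 0)"
  have q: "0 \<le> q" "q < 1" using \<delta> by (auto simp: q_def)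
  \<comment> \<open>Beyond \<open>l\<close> the iterates equal the fixed point exactly, so only a
    next point before \<open>l\<close> can transmit an error.\<close>
  have al: "a n t = 1" if "l \<le> t" for n t
    using that
  proof (induction n arbitrary: t)
    case (Suc n)
    have "a (Suc n) t = (\<integral>y. 1 \<partial>exp_law \<delta>)"
      unfolding aSuc using pos Suc by (intro integral_cong_AE) (auto simp: hl)
    then show ?case by simp
  qed (simp add: a0)
  have bound: "\<bar>a n t - \<alpha> t\<bar> \<le> q ^ n" if "0 \<le> t" for n t
    using that
  proof (induction n arbitrary: t)
    case 0
    then show ?case using \<alpha>01[of t] by (simp add: a0)
  next
    case (Suc n)
    show ?case
    proof (cases "t \<le> l")
      case t: True
      have "(\<integral>y. indicator {..l} (t + y) \<partial>exp_law \<delta>)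
          = integral {t..l} (\<lambda>z. \<delta> * exp (- \<delta> * (z - t)) * indicator {..l} z)"
        by (rule integral_exp_law_shift[OF \<delta>, where B = 1]) (auto simp: indicator_def)
      also have "\<dots> = integral {t..l} (\<lambda>z. \<delta> * exp (- \<delta> * (z - t)))"
        by (rule Henstock_Kurzweil_Integration.integral_cong) auto
      also have "\<dots> = 1 - exp (- \<delta> * (l - t))" by (rule integral_exp_density[OF t])
      also have "\<dots> \<le> q"
        unfolding q_def using t Suc.prems \<delta> by auto
      finally have ind: "(\<integral>y. indicator {..l} (t + y) \<partial>exp_law \<delta>) \<le> q" .
      have i1: "integrable (exp_law \<delta>) (\<lambda>y. h (t + y) * a n (t + y))"
        by (rule E.integrable_const_bound[where B = 1]) (use abs_mult_le_1 h01 a01 in auto)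
      have i2: "integrable (exp_law \<delta>) (\<lambda>y. h (t + y) * \<alpha> (t + y))"
        by (rule E.integrable_const_bound[where B = 1]) (use abs_mult_le_1 h01 \<alpha>01 in auto)
      have i3: "integrable (exp_law \<delta>) (\<lambda>y. q ^ n * indicator {..l} (t + y))"
        by (rule E.integrable_const_bound[where B = "q ^ n"]) (use q in \<open>auto simp: indicator_def\<close>)
      have "\<bar>a (Suc n) t - \<alpha> t\<bar> = \<bar>\<integral>y. h (t + y) * a n (t + y) - h (t + y) * \<alpha> (t + y) \<partial>exp_law \<delta>\<bar>"
        unfolding aSuc using i1 i2 fp(5)[of t] by simp
      also have "\<dots> \<le> (\<integral>y. \<bar>h (t + y) * a n (t + y) - h (t + y) * \<alpha> (t + y)\<bar> \<partial>exp_law \<delta>)"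
        by (rule integral_abs_bound)
      also have "\<dots> \<le> (\<integral>y. q ^ n * indicator {..l} (t + y) \<partial>exp_law \<delta>)"
      proof (rule integral_mono_AE)
        have key: "\<bar>h z * a n z - h z * \<alpha> z\<bar> \<le> q ^ n * indicator {..l} z" if "t \<le> z" for z
        proof -
          have "\<bar>h z * a n z - h z * \<alpha> z\<bar> = \<bar>h z\<bar> * \<bar>a n z - \<alpha> z\<bar>"
            by (metis right_diff_distrib abs_mult)
          also have "\<dots> \<le> 1 * \<bar>a n z - \<alpha> z\<bar>"
            using h01[of z] by (intro mult_right_mono) auto
          also have "\<dots> \<le> q ^ n * indicator {..l} z"
          proof (cases "z \<le> l")
            case True
            then show ?thesis using Suc.IH[of z] Suc.prems that by simp
          next
            case False
            then show ?thesis using al[of z n] fp(4)[of z] by simp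
          qed
          finally show ?thesis .
        qed
        show "AE y in exp_law \<delta>. \<bar>h (t + y) * a n (t + y) - h (t + y) * \<alpha> (t + y)\<bar>
            \<le> q ^ n * indicator {..l} (t + y)"
          using pos by (rule AE_mp) (intro AE_I2 impI key, simp)
      qed (use i1 i2 i3 in auto)
      also have "\<dots> = q ^ n * (\<integral>y. indicator {..l} (t + y) \<partial>exp_law \<delta>)"
        by simp
      also have "\<dots> \<le> q ^ n * q"
        using ind q by (intro mult_left_mono) auto
      finally show ?thesis by (simp add: mult.commute)
    next
      case False
      then show ?thesis using al[of t "Suc n"] fp(4)[of t] q by simp
    qed
  qed
  have "(\<lambda>n. a n 0 - \<alpha> 0) \<longlonglongrightarrow> 0"
  proof (rule Lim_null_comparison)
    show "eventually (\<lambda>n. norm (a n 0 - \<alpha> 0) \<le> q ^ n) sequentially"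
      using bound[of 0] by simp
    show "(\<lambda>n. q ^ n) \<longlonglongrightarrow> 0" using q by (intro LIMSEQ_power_zero) auto
  qed
  then show ?thesis
    unfolding \<alpha>_def by (simp add: LIM_zero_iff)
qed

section \<open>The law of the tree\<close>

locale tree_law =
  fixes \<mu> :: "real measure" and \<delta> :: real
  assumes prob_space_life: "prob_space \<mu>" and sets_life [measurable_cong]: "sets \<mu> = sets borel"
    and life_pos: "AE l in \<mu>. 0 < l" and \<delta>_pos: "0 < \<delta>"
begin

definition law :: "individual + individual \<times> nat \<Rightarrow> real measure" where
  "law i = (case i of Inl _ \<Rightarrow> \<mu> | Inr _ \<Rightarrow> exp_law \<delta>)"

definition P :: "config measure" where
  "P = PiM UNIV law"

sublocale E: prob_space "exp_law \<delta>"
  by (rule prob_space_exponential_density[OF \<delta>_pos])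

sublocale life: prob_space \<mu>
  by (rule prob_space_life)

lemma prob_space_law: "prob_space (law i)"
  by (auto simp: law_def E.prob_space_axioms prob_space_life split: sum.split)

lemma sets_law [measurable_cong]: "sets (law i) = sets borel"
  by (auto simp: law_def sets_life split: sum.split)

sublocale P: prob_space P
  unfolding P_def by (intro prob_space_PiM prob_space_law)

lemma sets_P [measurable_cong]: "sets P = sets config_space"
  unfolding P_def by (intro sets_PiM_cong sets_law refl)

lemma space_P [simp]: "space P = UNIV"
  using sets_eq_imp_space_eq[OF sets_P] by (simp add: space_PiM)

text \<open>By \<open>inv\<close>, \<open>G\<close> factors through the coordinates other than
  \<open>i\<close>, and \<open>P\<close> is the product of \<open>law i\<close> with the law of
  those coordinates; so the two components are independent.\<close>

lemma distr_coordinate_pair: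
  assumes G[measurable]: "G \<in> measurable P N" and inv: "\<And>x z. G (x(i := z)) = G x"
  shows "distr P (law i \<Otimes>\<^sub>M N) (\<lambda>x. (x i, G x)) = law i \<Otimes>\<^sub>M distr P N G"
proof -
  interpret i: prob_space "law i" by (rule prob_space_law)
  let ?PI = "PiM (UNIV - {i}) law"
  interpret PI: prob_space ?PI by (intro prob_space_PiM prob_space_law)
  interpret pair: pair_prob_space "law i" ?PI ..
  interpret G: prob_space "distr P N G" by (rule P.prob_space_distr) measurable
  have ins: "insert i (UNIV - {i}) = (UNIV :: (individual + individual \<times> nat) set)" by auto
  have P_eq: "P = distr (law i \<Otimes>\<^sub>M ?PI) P (\<lambda>(y, X). X(i := y))"
    using distr_pair_PiM_eq_PiM[of "UNIV - {i}" law i] prob_space_law unfolding ins P_def by simp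
  have upd[measurable]: "(\<lambda>(y, X). X(i := y)) \<in> measurable (law i \<Otimes>\<^sub>M ?PI) P"
    using measurable_fun_upd[of UNIV "UNIV - {i}" i snd "law i \<Otimes>\<^sub>M ?PI" law fst] ins
    by (auto simp: P_def case_prod_beta)
  \<comment> \<open>The filler 0 is arbitrary: by \<open>inv\<close> the value of \<open>G\<close>
    does not depend on it.\<close>
  define G' where "G' X = G (X(i := 0))" for X
  have G'[measurable]: "G' \<in> measurable ?PI N"
  proof -
    have "(\<lambda>X. G ((\<lambda>(y, X). X(i := y)) (0, X))) \<in> measurable ?PI N"
    proof (rule measurable_compose[OF _ G])
      have "(\<lambda>X. (0, X)) \<in> measurable ?PI (law i \<Otimes>\<^sub>M ?PI)"
        using sets_eq_imp_space_eq[OF sets_law[of i]] by (intro measurable_Pair1') simp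
      from measurable_compose[OF this upd] show "(\<lambda>X. (\<lambda>(y, X). X(i := y)) (0, X)) \<in> measurable ?PI P" .
    qed
    then show ?thesis by (simp add: G'_def[abs_def])
  qed
  have G_upd: "G (X(i := y)) = G' X" for X y
    using inv[of "X(i := 0)" y] by (simp add: G'_def)
  have coord[measurable]: "(\<lambda>x. x i) \<in> measurable P (law i)"
    unfolding P_def by measurable
  have joint: "emeasure P {x. x i \<in> A \<and> G x \<in> B} = emeasure (law i) A * emeasure ?PI {X\<in>space ?PI. G' X \<in> B}"
    if [measurable]: "A \<in> sets (law i)" "B \<in> sets N" for A B
  proof -
    have m: "{x. x i \<in> A \<and> G x \<in> B} \<in> sets P"
    proof -
      have "{x \<in> space P. x i \<in> A \<and> G x \<in> B} \<in> sets P" by measurable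
      then show ?thesis by simp
    qed
    have "emeasure P {x. x i \<in> A \<and> G x \<in> B}
        = emeasure (law i \<Otimes>\<^sub>M ?PI) ((\<lambda>(y, X). X(i := y)) -` {x. x i \<in> A \<and> G x \<in> B} \<inter> space (law i \<Otimes>\<^sub>M ?PI))"
      by (subst P_eq) (rule emeasure_distr[OF upd m])
    also have "(\<lambda>(y, X). X(i := y)) -` {x. x i \<in> A \<and> G x \<in> B} \<inter> space (law i \<Otimes>\<^sub>M ?PI)
        = A \<times> {X\<in>space ?PI. G' X \<in> B}"
      using sets.sets_into_space[OF that(1)]
      by (auto simp: space_pair_measure G_upd)
    also have "emeasure (law i \<Otimes>\<^sub>M ?PI) \<dots> = emeasure (law i) A * emeasure ?PI {X\<in>space ?PI. G' X \<in> B}"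
      by (rule PI.emeasure_pair_measure_Times) measurable
    finally show ?thesis .
  qed
  show ?thesis
  proof (rule pair_measure_eqI[symmetric])
    fix A B assume A[measurable]: "A \<in> sets (law i)" and "B \<in> sets (distr P N G)"
    then have B[measurable]: "B \<in> sets N" by simp
    have "emeasure (distr P N G) B = emeasure P {x. x i \<in> space (law i) \<and> G x \<in> B}"
      using sets_eq_imp_space_eq[OF sets_law[of i]]
      by (subst emeasure_distr[OF G B]) (auto intro!: arg_cong[where f = "emeasure P"])
    also have "\<dots> = emeasure ?PI {X\<in>space ?PI. G' X \<in> B}"
      by (subst joint) (auto simp: i.emeasure_space_1)
    finally have "emeasure (law i) A * emeasure (distr P N G) B = emeasure P {x. x i \<in> A \<and> G x \<in> B}"
      using joint[OF A B] by simp
    also have "\<dots> = emeasure (distr P (law i \<Otimes>\<^sub>M N) (\<lambda>x. (x i, G x))) (A \<times> B)"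
      by (subst emeasure_distr) (auto intro!: arg_cong[where f = "emeasure P"])
    finally show "emeasure (law i) A * emeasure (distr P N G) B
      = emeasure (distr P (law i \<Otimes>\<^sub>M N) (\<lambda>x. (x i, G x))) (A \<times> B)" .
  next
    show "sets (law i \<Otimes>\<^sub>M distr P N G) = sets (distr P (law i \<Otimes>\<^sub>M N) (\<lambda>x. (x i, G x)))"
      by (simp cong: sets_pair_measure_cong)
  qed (rule i.sigma_finite_measure_axioms G.sigma_finite_measure_axioms)+
qed

lemma law_sub_index: "law (sub_index k i) = law i"
  by (cases i) (auto simp: law_def sub_index_def)

text \<open>The branching property: \<open>sub_index k\<close> is injective and sends life-lengths
  to life-lengths and gaps to gaps, so the selected coordinates have the same product law.\<close>

lemma distr_subtree: "distr P P (subtree k) = P"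
  using distr_PiM_reindex[of UNIV law "sub_index k" UNIV] prob_space_law inj_sub_index[of k]
  by (simp add: P_def law_sub_index subtree_def[abs_def] restrict_UNIV)

text \<open>The \<open>k\<close>-th gap, and not the birth point, is paired with the
  \<open>k\<close>-th subtree: different birth points share gaps, whereas these pairs are
  independent and identically distributed.\<close>

definition branch :: "nat \<Rightarrow> config \<Rightarrow> real \<times> config" where
  "branch k x = (gap [] k x, subtree k x)"

lemma measurable_branch [measurable]: "branch k \<in> measurable P (exp_law \<delta> \<Otimes>\<^sub>M P)"
  unfolding branch_def by measurable

lemma distr_branch: "distr P (exp_law \<delta> \<Otimes>\<^sub>M P) (branch k) = exp_law \<delta> \<Otimes>\<^sub>M P"
proof -
  have "subtree k (x(Inr ([], k) := z)) = subtree k x" for x z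
    by (simp add: subtree_def)
  then show ?thesis
    using distr_coordinate_pair[of "subtree k" P "Inr ([], k)"]
    by (simp add: distr_subtree law_def branch_def[abs_def])
qed

lemma indep_vars_coordinates: "P.indep_vars law (\<lambda>i x. x i) UNIV"
proof (subst P.indep_vars_iff_distr_eq_PiM)
  show "distr P (PiM UNIV law) (\<lambda>x. \<lambda>i\<in>UNIV. x i) = (\<Pi>\<^sub>M i\<in>UNIV. distr P (law i) (\<lambda>x. x i))"
    using distr_PiM_component[of UNIV law] prob_space_law by (simp add: P_def restrict_UNIV)
qed (auto simp: P_def)

text \<open>Branch \<open>k\<close> reads only the coordinates in \<open>K k\<close>. These sets are
  disjoint: words of different subtrees end in different letters, and the gaps of the ancestor carry
  the empty word.\<close>

lemma indep_vars_branch: "P.indep_vars (\<lambda>_. exp_law \<delta> \<Otimes>\<^sub>M P) branch UNIV"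
proof -
  define K where "K k = insert (Inr ([], k)) (range (sub_index k))" for k
  have "disjoint_family K"
    by (auto simp: disjoint_family_on_def K_def sub_index_neq[symmetric] simp del: sub_index_neq
        dest: sub_index_eqD)
  then have "P.indep_vars (\<lambda>k. PiM (K k) law) (\<lambda>k x. restrict (\<lambda>i. x i) (K k)) UNIV"
    by (intro P.indep_vars_restrict[OF indep_vars_coordinates]) auto
  then have "P.indep_vars (\<lambda>_. exp_law \<delta> \<Otimes>\<^sub>M P)
      (\<lambda>k x. (\<lambda>y. (y (Inr ([], k)), \<lambda>i. y (sub_index k i))) (restrict (\<lambda>i. x i) (K k))) UNIV"
  proof (rule P.indep_vars_compose2)
    fix k
    have "(\<lambda>y. y (Inr ([], k))) \<in> measurable (PiM (K k) law) (law (Inr ([], k)))"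
      by (intro measurable_component_singleton) (simp add: K_def)
    moreover have "(\<lambda>y i. y (sub_index k i)) \<in> measurable (PiM (K k) law) P"
      unfolding P_def
    proof (rule measurable_PiM_single')
      fix i
      have "(\<lambda>y. y (sub_index k i)) \<in> measurable (PiM (K k) law) (law (sub_index k i))"
        by (intro measurable_component_singleton) (simp add: K_def)
      then show "(\<lambda>y. y (sub_index k i)) \<in> measurable (PiM (K k) law) (law i)"
        by (simp add: law_sub_index)
    qed (use sets_eq_imp_space_eq[OF sets_law] in auto)
    ultimately show "(\<lambda>y. (y (Inr ([], k)), \<lambda>i. y (sub_index k i)))
        \<in> measurable (PiM (K k) law) (exp_law \<delta> \<Otimes>\<^sub>M P)"
      by (intro measurable_Pair) (simp_all add: law_def)
  qed
  then show ?thesis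
    by (simp add: K_def branch_def[abs_def] subtree_def)
qed

section \<open>The sequence of all branches\<close>

abbreviation S :: "(nat \<Rightarrow> real \<times> config) measure" where
  "S \<equiv> PiM UNIV (\<lambda>_. exp_law \<delta> \<Otimes>\<^sub>M P)"

lemma measurable_branches [measurable]: "(\<lambda>x k. branch k x) \<in> measurable P S"
  by (intro measurable_PiM_single') (auto simp: space_pair_measure)

lemma distr_branches: "distr P S (\<lambda>x k. branch k x) = S"
proof -
  have "distr P S (\<lambda>x. \<lambda>k\<in>UNIV. branch k x) = (\<Pi>\<^sub>M k\<in>UNIV. distr P (exp_law \<delta> \<Otimes>\<^sub>M P) (branch k))"
    using indep_vars_branch by (subst (asm) P.indep_vars_iff_distr_eq_PiM) auto
  then show ?thesis by (simp add: distr_branch restrict_UNIV)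
qed

text \<open>No branch reads the life-length of the ancestor, which is therefore independent of the
  whole sequence of branches.\<close>

lemma distr_root: "distr P (\<mu> \<Otimes>\<^sub>M S) (\<lambda>x. (life [] x, \<lambda>k. branch k x)) = \<mu> \<Otimes>\<^sub>M S"
proof -
  have "branch k (x(Inl [] := z)) = branch k x" for k x z
    by (simp add: branch_def subtree_def)
  then show ?thesis
    using distr_coordinate_pair[of "\<lambda>x k. branch k x" S "Inl []"]
    by (simp add: distr_branches law_def)
qed

sublocale EP: pair_prob_space "exp_law \<delta>" P ..

sublocale S: prob_space S
  by (intro prob_space_PiM EP.prob_space_axioms)

text \<open>Makes available that prepending an independent branch by \<open>case_nat\<close>
  preserves \<open>S\<close>; this shift drives the recursion over the children.\<close>

sublocale EP: sequence_space "exp_law \<delta> \<Otimes>\<^sub>M P"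
  by (simp add: sequence_space_def product_prob_spaceI EP.prob_space_axioms)

section \<open>The generating function\<close>

lemma AE_gaps_nonneg: "AE x in P. \<forall>i. 0 \<le> x (Inr i)"
proof (subst AE_all_countable, rule allI)
  fix i :: "individual \<times> nat"
  have law_eq: "law (Inr i) = exp_law \<delta>"
    by (simp add: law_def)
  have distr_eq: "distr P (law (Inr i)) (\<lambda>x. x (Inr i)) = law (Inr i)"
    unfolding P_def by (rule distr_PiM_component) (auto simp: prob_space_law)
  have "AE y in distr P (law (Inr i)) (\<lambda>x. x (Inr i)). 0 \<le> y"
    unfolding distr_eq unfolding law_eq by (auto simp: AE_density exponential_density_def)
  then show "AE x in P. 0 \<le> x (Inr i)"
    by (subst (asm) AE_distr_iff) (auto simp: P_def)
qed

definition F :: "real \<Rightarrow> real \<Rightarrow> real" where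
  "F s u = (\<integral>x. weight s (pop u x) \<partial>P)"

text \<open>Contribution to the generating function of a potential child \<open>x\<close> born at age \<open>t\<close> of a
  parent with life-length \<open>l\<close>.\<close>

definition child_weight :: "real \<Rightarrow> real \<Rightarrow> real \<Rightarrow> real \<Rightarrow> config \<Rightarrow> real" where
  "child_weight s u l t x = (if t < l then weight s (pop (u - t) x) else 1)"

text \<open>The starting age \<open>t\<close> is left free so that peeling off the first branch
  yields the same functional, started at the age of the first birth.\<close>

definition children_weight :: "real \<Rightarrow> real \<Rightarrow> real \<Rightarrow> nat \<Rightarrow> real \<Rightarrow> (nat \<Rightarrow> real \<times> config) \<Rightarrow> real" where
  "children_weight s u l n t \<omega> = (\<Prod>k<n. child_weight s u l (t + (\<Sum>i\<le>k. fst (\<omega> i))) (snd (\<omega> k)))"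

lemma measurable_weight_pop' [measurable (raw)]:
  assumes [measurable]: "u \<in> borel_measurable N" "X \<in> measurable N P"
  shows "(\<lambda>z. weight s (pop (u z) (X z))) \<in> borel_measurable N"
proof -
  have [measurable]: "X \<in> measurable N config_space"
    using assms(2) measurable_cong_sets[OF refl sets_P, of N] by simp
  have "(\<lambda>z. (u z, X z)) \<in> measurable N (borel \<Otimes>\<^sub>M config_space)"
    by measurable
  from measurable_compose[OF this measurable_weight_pop[of s]] show ?thesis by simp
qed

lemma measurable_F [measurable]: "F s \<in> borel_measurable borel"
  unfolding F_def by measurable

lemma measurable_child_weight [measurable (raw)]:
  assumes [measurable]: "l \<in> borel_measurable N" "t \<in> borel_measurable N" "X \<in> measurable N P"
  shows "(\<lambda>z. child_weight s u (l z) (t z) (X z)) \<in> borel_measurable N"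
  unfolding child_weight_def by measurable

lemma measurable_children_weight [measurable (raw)]:
  assumes [measurable]: "l \<in> borel_measurable N" "t \<in> borel_measurable N" "\<omega> \<in> measurable N S"
  shows "(\<lambda>z. children_weight s u (l z) n (t z) (\<omega> z)) \<in> borel_measurable N"
proof -
  have k: "(\<lambda>z. \<omega> z k) \<in> measurable N (exp_law \<delta> \<Otimes>\<^sub>M P)" for k
    by measurable
  have [measurable]: "(\<lambda>z. fst (\<omega> z k)) \<in> borel_measurable N" "(\<lambda>z. snd (\<omega> z k)) \<in> measurable N P" for k
    using measurable_compose[OF k measurable_fst] measurable_compose[OF k measurable_snd]
    by simp_all
  show ?thesis
    unfolding children_weight_def by measurable
qed

lemma children_weight_Suc:
  "children_weight s u l (Suc n) t (case_nat z \<omega>)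
    = child_weight s u l (t + fst z) (snd z) * children_weight s u l n (t + fst z) \<omega>"
  unfolding children_weight_def
  by (subst prod.lessThan_Suc_shift) (simp add: sum.atMost_Suc_shift add.assoc del: sum.atMost_Suc)

context
  fixes s :: real
  assumes s: "0 \<le> s" "s < 1"
begin

lemma weight_01:
  fixes A :: "individual set"
  shows "0 \<le> weight s A" "weight s A \<le> 1"
  using s by (auto intro: weight_nonneg weight_le_1)

lemma F_01: "0 \<le> F s u" "F s u \<le> 1"
proof -
  have "integrable P (\<lambda>x. weight s (pop u x))"
    by (rule P.integrable_const_bound[where B = 1]) (use weight_01 in auto)
  then show "0 \<le> F s u" "F s u \<le> 1"
    unfolding F_def using weight_01 by (auto intro!: integral_nonneg_AE P.integral_le_const)
qed

lemma F_neg: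
  assumes "u < 0"
  shows "F s u = 1"
proof -
  have "F s u = (\<integral>x. 1 \<partial>P)"
    unfolding F_def
    by (rule integral_cong_AE) (use AE_gaps_nonneg pop_empty[OF _ assms] in auto)
  then show ?thesis by (simp add: P.prob_space[simplified])
qed

lemma child_weight_01: "0 \<le> child_weight s u l t x" "child_weight s u l t x \<le> 1"
  using weight_01 by (auto simp: child_weight_def)

lemma children_weight_01: "0 \<le> children_weight s u l n t \<omega>" "children_weight s u l n t \<omega> \<le> 1"
  unfolding children_weight_def using child_weight_01 by (auto intro!: prod_nonneg prod_le_1)

lemma expected_child_weight:
  "(\<integral>x. child_weight s u l t x \<partial>P) = (if t < l then F s (u - t) else 1)"
  by (simp add: child_weight_def F_def P.prob_space[simplified])

lemma expected_children_weight_01: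
  "0 \<le> (\<integral>\<omega>. children_weight s u l n t \<omega> \<partial>S)" "(\<integral>\<omega>. children_weight s u l n t \<omega> \<partial>S) \<le> 1"
proof -
  have "integrable S (\<lambda>\<omega>. children_weight s u l n t \<omega>)"
    by (rule S.integrable_const_bound[where B = 1]) (use children_weight_01 in auto)
  then show "0 \<le> (\<integral>\<omega>. children_weight s u l n t \<omega> \<partial>S)" "(\<integral>\<omega>. children_weight s u l n t \<omega> \<partial>S) \<le> 1"
    using children_weight_01 by (auto intro!: integral_nonneg_AE S.integral_le_const)
qed

text \<open>Given the first gap \<open>y\<close>, the first subtree contributes
  \<open>F s (u - (t + y))\<close> if the parent is still alive, and the remaining branches are a
  fresh independent sequence started at age \<open>t + y\<close>.\<close>

lemma expected_children_weight_Suc: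
  "(\<integral>\<omega>. children_weight s u l (Suc n) t \<omega> \<partial>S)
    = (\<integral>y. (if t + y < l then F s (u - (t + y)) else 1) * (\<integral>\<omega>. children_weight s u l n (t + y) \<omega> \<partial>S) \<partial>exp_law \<delta>)"
proof -
  interpret EPS: pair_prob_space "exp_law \<delta> \<Otimes>\<^sub>M P" S ..
  let ?f = "\<lambda>(z, \<omega>). child_weight s u l (t + fst z) (snd z) * children_weight s u l n (t + fst z) \<omega>"
  let ?A = "\<lambda>t. \<integral>\<omega>. children_weight s u l n t \<omega> \<partial>S"
  have m[measurable]: "(\<lambda>(z, \<omega>). case_nat z \<omega>) \<in> measurable ((exp_law \<delta> \<Otimes>\<^sub>M P) \<Otimes>\<^sub>M S) S"
    by measurable
  have "(\<integral>\<omega>. children_weight s u l (Suc n) t \<omega> \<partial>S)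
      = (\<integral>\<omega>. children_weight s u l (Suc n) t \<omega> \<partial>distr ((exp_law \<delta> \<Otimes>\<^sub>M P) \<Otimes>\<^sub>M S) S (\<lambda>(z, \<omega>). case_nat z \<omega>))"
    by (simp add: EP.PiM_iter)
  also have "\<dots> = (\<integral>p. ?f p \<partial>((exp_law \<delta> \<Otimes>\<^sub>M P) \<Otimes>\<^sub>M S))"
    by (subst integral_distr[OF m]) (auto simp: case_prod_beta' children_weight_Suc)
  also have "\<dots> = (\<integral>z. \<integral>\<omega>. ?f (z, \<omega>) \<partial>S \<partial>(exp_law \<delta> \<Otimes>\<^sub>M P))"
    by (rule EPS.integral_fst'[symmetric], rule EPS.integrable_const_bound[where B = 1])
      (use abs_mult_le_1 child_weight_01 children_weight_01 in auto)
  also have "\<dots> = (\<integral>z. child_weight s u l (t + fst z) (snd z) * ?A (t + fst z) \<partial>(exp_law \<delta> \<Otimes>\<^sub>M P))"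
    by simp
  also have "\<dots> = (\<integral>y. \<integral>x. child_weight s u l (t + y) x * ?A (t + y) \<partial>P \<partial>exp_law \<delta>)"
  proof (subst EP.integral_fst'[symmetric])
    show "integrable (exp_law \<delta> \<Otimes>\<^sub>M P) (\<lambda>z. child_weight s u l (t + fst z) (snd z) * ?A (t + fst z))"
      by (rule EP.integrable_const_bound[where B = 1])
        (use abs_mult_le_1 child_weight_01 expected_children_weight_01 in auto)
  qed simp
  finally show ?thesis
    by (simp add: expected_child_weight)
qed

lemma expected_children_weight_tendsto:
  "(\<lambda>n. \<integral>\<omega>. children_weight s u l n 0 \<omega> \<partial>S) \<longlonglongrightarrow> exp (- \<delta> * integral {0..l} (\<lambda>y. 1 - F s (u - y)))"
proof -
  let ?h = "\<lambda>t. if t < l then F s (u - t) else 1"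
  have "(\<lambda>n. \<integral>\<omega>. children_weight s u l n 0 \<omega> \<partial>S) \<longlonglongrightarrow> exp (- \<delta> * integral {0..l} (\<lambda>y. 1 - ?h y))"
  proof (rule poisson_iteration_tendsto[OF \<delta>_pos])
    show "(\<integral>\<omega>. children_weight s u l (Suc n) t \<omega> \<partial>S)
      = (\<integral>y. ?h (t + y) * (\<integral>\<omega>. children_weight s u l n (t + y) \<omega> \<partial>S) \<partial>exp_law \<delta>)" for n t
      by (rule expected_children_weight_Suc)
    show "(\<integral>\<omega>. children_weight s u l 0 t \<omega> \<partial>S) = 1" for t
      by (simp add: children_weight_def S.prob_space[simplified])
  qed (use F_01 expected_children_weight_01 in auto)
  \<comment> \<open>On the interval the two integrands can differ only at the endpoint
    \<open>l\<close>.\<close>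
  also have "integral {0..l} (\<lambda>y. 1 - ?h y) = integral {0..l} (\<lambda>y. 1 - F s (u - y))"
    by (rule integral_spike[of "{l}"]) auto
  finally show ?thesis .
qed

text \<open>For \<open>n\<close> potential children the identity is the independence of the
  ancestor's life-length from the branches. Dominated convergence removes the truncation on both
  sides: pathwise under \<open>P\<close>, and for each fixed \<open>l\<close> through the Poisson
  iteration.\<close>

lemma F_integral_equation:
  assumes u: "0 \<le> u"
  shows "F s u = (\<integral>l. (if u < l then s else 1) * exp (- \<delta> * integral {0..l} (\<lambda>y. 1 - F s (u - y))) \<partial>\<mu>)"
proof -
  interpret mS: pair_prob_space \<mu> S ..
  let ?r = "\<lambda>l. if u < l then s else 1"
  have r: "0 \<le> ?r l" "?r l \<le> 1" for l using s by auto
  have "(\<lambda>n. \<integral>x. ?r (life [] x) * children_weight s u (life [] x) n 0 (\<lambda>k. branch k x) \<partial>P) \<longlonglongrightarrow> F s u"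
    unfolding F_def
  proof (rule integral_dominated_convergence[where w = "\<lambda>_. 1"])
    show "AE x in P. (\<lambda>n. ?r (life [] x) * children_weight s u (life [] x) n 0 (\<lambda>k. branch k x))
        \<longlonglongrightarrow> weight s (pop u x)"
      using weight_pop_tendsto[OF s u, unfolded birth_point_def]
      by (intro AE_I2) (simp add: children_weight_def child_weight_def branch_def)
    show "AE x in P. norm (?r (life [] x) * children_weight s u (life [] x) n 0 (\<lambda>k. branch k x)) \<le> 1" for n
      by (intro AE_I2) (use abs_mult_le_1 r children_weight_01 in auto)
  qed auto
  moreover have "(\<integral>x. ?r (life [] x) * children_weight s u (life [] x) n 0 (\<lambda>k. branch k x) \<partial>P)
      = (\<integral>l. ?r l * (\<integral>\<omega>. children_weight s u l n 0 \<omega> \<partial>S) \<partial>\<mu>)" for n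
  proof -
    have m: "(\<lambda>x. (life [] x, \<lambda>k. branch k x)) \<in> measurable P (\<mu> \<Otimes>\<^sub>M S)" by measurable
    have "(\<integral>x. ?r (life [] x) * children_weight s u (life [] x) n 0 (\<lambda>k. branch k x) \<partial>P)
        = (\<integral>p. ?r (fst p) * children_weight s u (fst p) n 0 (snd p) \<partial>distr P (\<mu> \<Otimes>\<^sub>M S) (\<lambda>x. (life [] x, \<lambda>k. branch k x)))"
      by (subst integral_distr[OF m]) auto
    also have "\<dots> = (\<integral>l. \<integral>\<omega>. ?r l * children_weight s u l n 0 \<omega> \<partial>S \<partial>\<mu>)"
    proof (subst distr_root, subst mS.integral_fst'[symmetric])
      show "integrable (\<mu> \<Otimes>\<^sub>M S) (\<lambda>p. ?r (fst p) * children_weight s u (fst p) n 0 (snd p))"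
        by (rule mS.integrable_const_bound[where B = 1]) (use abs_mult_le_1 r children_weight_01 in auto)
    qed simp
    finally show ?thesis by simp
  qed
  moreover have "(\<lambda>n. \<integral>l. ?r l * (\<integral>\<omega>. children_weight s u l n 0 \<omega> \<partial>S) \<partial>\<mu>)
      \<longlonglongrightarrow> (\<integral>l. ?r l * exp (- \<delta> * integral {0..l} (\<lambda>y. 1 - F s (u - y))) \<partial>\<mu>)"
  proof (rule integral_dominated_convergence[where w = "\<lambda>_. 1"])
    show "AE l in \<mu>. (\<lambda>n. ?r l * (\<integral>\<omega>. children_weight s u l n 0 \<omega> \<partial>S))
        \<longlonglongrightarrow> ?r l * exp (- \<delta> * integral {0..l} (\<lambda>y. 1 - F s (u - y)))"
      by (intro AE_I2 tendsto_mult tendsto_const expected_children_weight_tendsto)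
    show "AE l in \<mu>. norm (?r l * (\<integral>\<omega>. children_weight s u l n 0 \<omega> \<partial>S)) \<le> 1" for n
      by (intro AE_I2) (use abs_mult_le_1 r expected_children_weight_01 in auto)
    have "continuous_on UNIV (\<lambda>l. integral {0..l} (\<lambda>y. 1 - F s (u - y)))"
      by (rule indefinite_integral_continuous[where B = 1]) (use F_01 in auto)
    then have [measurable]: "(\<lambda>l. integral {0..l} (\<lambda>y. 1 - F s (u - y))) \<in> borel_measurable borel"
      by (rule borel_measurable_continuous_onI)
    show "(\<lambda>l. ?r l * exp (- \<delta> * integral {0..l} (\<lambda>y. 1 - F s (u - y)))) \<in> borel_measurable \<mu>"
      by measurable
  qed auto
  ultimately show ?thesis
    by (auto intro: LIMSEQ_unique)
qed

text \<open>Reflecting at \<open>u\<close> makes the exponent an increment, so the exponential in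
  the integral equation becomes \<open>H s (u - l) / H s u\<close>. For \<open>l > u\<close> the
  part left of 0 contributes nothing because \<open>F s\<close> is 1 there, and the last integral is
  over an empty interval.\<close>

lemma integral_complement_F_shift:
  assumes u: "0 \<le> u" and l: "0 < l"
  shows "integral {0..l} (\<lambda>y. 1 - F s (u - y))
    = integral {0..u} (\<lambda>y. 1 - F s y) - integral {0..u - l} (\<lambda>y. 1 - F s y)"
proof -
  have b: "\<bar>1 - F s y\<bar> \<le> 1" for y using F_01[of y] by auto
  have int: "(\<lambda>y. 1 - F s y) integrable_on {a..c}" for a c
    by (rule bounded_borel_integrable_on) (use b in auto)
  have "integral {0..l} (\<lambda>y. 1 - F s (u - y)) = (\<integral>y. indicator {0..l} y * (1 - F s (u - y)) \<partial>lborel)"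
    by (rule bounded_borel_integral_eq) (use b in auto)
  also have "\<dots> = (\<integral>y. indicator {u - l..u} y * (1 - F s y) \<partial>lborel)"
    by (subst (2) lborel_integral_real_affine[of "-1" _ u])
      (auto simp: indicator_def intro!: Bochner_Integration.integral_cong)
  also have "\<dots> = integral {u - l..u} (\<lambda>y. 1 - F s y)"
    by (rule bounded_borel_integral_eq[symmetric]) (use b in auto)
  also have "\<dots> = integral {0..u} (\<lambda>y. 1 - F s y) - integral {0..u - l} (\<lambda>y. 1 - F s y)"
  proof (cases "0 \<le> u - l")
    case True
    then show ?thesis using integral_diff_eq[OF int True] l by simp
  next
    case False
    have "integral {u - l..0} (\<lambda>y. 1 - F s y) = integral {u - l..0} (\<lambda>y. 0)"
      by (rule integral_spike[of "{0}"]) (use F_neg in auto)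
    then show ?thesis
      using Henstock_Kurzweil_Integration.integral_combine[OF _ u int, of "u - l"] False by simp
  qed
  finally show ?thesis .
qed

end

text \<open>For \<open>t \<le> 0\<close> the integral is \<open>0\<close>, consistently with \<open>F s u = 1\<close> for \<open>u < 0\<close>.\<close>

definition H :: "real \<Rightarrow> real \<Rightarrow> real" where
  "H s t = exp (\<delta> * integral {0..t} (\<lambda>y. 1 - F s y))"

lemma F_mult_H:
  assumes s: "0 \<le> s" "s < 1" and u: "0 \<le> u"
  shows "F s u * H s u = (\<integral>l. (if u < l then s else 1) * H s (u - l) \<partial>\<mu>)"
proof -
  have "continuous_on UNIV (\<lambda>t. integral {0..t} (\<lambda>y. 1 - F s y))"
    by (rule indefinite_integral_continuous[where B = 1]) (use F_01[OF s] in auto)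
  from borel_measurable_continuous_onI[OF this]
  have [measurable]: "(\<lambda>t. integral {0..t} (\<lambda>y. 1 - F s y)) \<in> borel_measurable borel" .
  have "continuous_on UNIV (\<lambda>l. integral {0..l} (\<lambda>y. 1 - F s (u - y)))"
    by (rule indefinite_integral_continuous[where B = 1]) (use F_01[OF s] in auto)
  from borel_measurable_continuous_onI[OF this]
  have [measurable]: "(\<lambda>l. integral {0..l} (\<lambda>y. 1 - F s (u - y))) \<in> borel_measurable borel" .
  have "F s u * H s u
      = (\<integral>l. ((if u < l then s else 1) * exp (- \<delta> * integral {0..l} (\<lambda>y. 1 - F s (u - y)))) * H s u \<partial>\<mu>)"
    using F_integral_equation[OF s u] by simp
  also have "\<dots> = (\<integral>l. (if u < l then s else 1) * H s (u - l) \<partial>\<mu>)"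
  proof (rule integral_cong_AE)
    show "AE l in \<mu>. ((if u < l then s else 1) * exp (- \<delta> * integral {0..l} (\<lambda>y. 1 - F s (u - y)))) * H s u
        = (if u < l then s else 1) * H s (u - l)"
      using life_pos
    proof eventually_elim
      case (elim l)
      have "exp (- \<delta> * integral {0..l} (\<lambda>y. 1 - F s (u - y))) * H s u = H s (u - l)"
        unfolding H_def mult_exp_exp integral_complement_F_shift[OF s u elim] by (simp add: algebra_simps)
      then show ?case by simp
    qed
  qed (auto simp: H_def)
  finally show ?thesis .
qed

section \<open>The renewal equation\<close>

lemma fubini_bounded:
  fixes g :: "real \<Rightarrow> real \<Rightarrow> real"
  assumes g[measurable]: "case_prod g \<in> borel_measurable (borel \<Otimes>\<^sub>M borel)"
    and B: "\<And>y l. y \<in> {0..t} \<Longrightarrow> \<bar>g y l\<bar> \<le> B"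
  shows "(\<integral>y. indicator {0..t} y * (\<integral>l. g y l \<partial>\<mu>) \<partial>lborel) = (\<integral>l. (\<integral>y. indicator {0..t} y * g y l \<partial>lborel) \<partial>\<mu>)"
proof -
  interpret lm: pair_sigma_finite lborel \<mu> ..
  have sp: "space \<mu> = UNIV" using sets_eq_imp_space_eq[OF sets_life] by simp
  have [measurable]: "{0..t} \<times> (UNIV :: real set) \<in> sets (lborel \<Otimes>\<^sub>M \<mu>)"
    using sets.top[of \<mu>] sp by (intro pair_measureI) auto
  have "emeasure (lborel \<Otimes>\<^sub>M \<mu>) ({0..t} \<times> UNIV) = emeasure lborel {0..t} * emeasure \<mu> UNIV"
    using sets.top[of \<mu>] sp by (intro life.emeasure_pair_measure_Times) auto
  also have "\<dots> < \<infinity>"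
    using life.emeasure_space_1 sp by (simp add: emeasure_lborel_Icc_eq)
  finally have "integrable (lborel \<Otimes>\<^sub>M \<mu>) (\<lambda>p. indicator ({0..t} \<times> UNIV) p * B)"
    by (intro integrable_mult_left integrable_real_indicator) auto
  then have int: "integrable (lborel \<Otimes>\<^sub>M \<mu>) (\<lambda>(y, l). indicator {0..t} y * g y l)"
  proof (rule Bochner_Integration.integrable_bound)
    show "AE p in lborel \<Otimes>\<^sub>M \<mu>. norm (case p of (y, l) \<Rightarrow> indicator {0..t} y * g y l)
        \<le> norm (indicator ({0..t} \<times> UNIV) p * B)"
      using order_trans[OF B abs_ge_self] by (intro AE_I2) (auto simp: indicator_def)
  qed measurable
  show "(\<integral>y. indicator {0..t} y * (\<integral>l. g y l \<partial>\<mu>) \<partial>lborel) = (\<integral>l. (\<integral>y. indicator {0..t} y * g y l \<partial>lborel) \<partial>\<mu>)"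
    using lm.Fubini_integral[OF int] by simp
qed

definition tail :: "real \<Rightarrow> real" where
  "tail y = (\<integral>l. indicator {..<l} y \<partial>\<mu>)"

lemma measurable_indicator_lessThan [measurable (raw)]:
  fixes f g :: "'b \<Rightarrow> real"
  assumes [measurable]: "f \<in> borel_measurable N" "g \<in> borel_measurable N"
  shows "(\<lambda>z. indicator {..<g z} (f z) :: real) \<in> borel_measurable N"
  unfolding indicator_def lessThan_iff by measurable

lemma measurable_tail [measurable]: "tail \<in> borel_measurable borel"
  unfolding tail_def by measurable

lemma tail_01: "0 \<le> tail y" "tail y \<le> 1"
proof -
  have "integrable \<mu> (\<lambda>l. indicator {..<l} y :: real)"
    by (rule life.integrable_const_bound[where B = 1]) (auto simp: indicator_def)
  then show "0 \<le> tail y" "tail y \<le> 1"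
    unfolding tail_def by (auto intro!: integral_nonneg_AE life.integral_le_const simp: indicator_def)
qed

text \<open>Subtracting 1 makes the function vanish for \<open>t \<le> 0\<close>, so that shifts by
  \<open>l\<close> create no boundary terms.\<close>

definition V :: "real \<Rightarrow> real \<Rightarrow> real" where
  "V s t = H s t - 1"

context
  fixes s :: real
  assumes s: "0 \<le> s" "s < 1"
begin

lemma complement_F_integrable: "(\<lambda>y. 1 - F s y) integrable_on {a..b}"
  by (rule bounded_borel_integrable_on[where B = 1]) (use F_01[OF s] in auto)

lemma integral_complement_F_nonneg: "0 \<le> integral {a..b} (\<lambda>y. 1 - F s y)"
  by (intro integral_nonneg complement_F_integrable) (use F_01[OF s] in auto)

lemma measurable_V [measurable]: "V s \<in> borel_measurable borel"
proof -
  have "continuous_on UNIV (\<lambda>t. integral {0..t} (\<lambda>y. 1 - F s y))"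
    by (rule indefinite_integral_continuous[where B = 1]) (use F_01[OF s] in auto)
  from borel_measurable_continuous_onI[OF this] show ?thesis
    unfolding V_def[abs_def] H_def by measurable
qed

lemma V_nonneg: "0 \<le> V s t"
  using integral_complement_F_nonneg \<delta>_pos by (simp add: V_def H_def)

lemma V_nonpos_eq_0: "t \<le> 0 \<Longrightarrow> V s t = 0"
  by (cases "t = 0") (auto simp: V_def H_def)

lemma V_mono: "t \<le> t' \<Longrightarrow> V s t \<le> V s t'"
proof (cases "0 \<le> t")
  case True
  assume "t \<le> t'"
  have "integral {0..t} (\<lambda>y. 1 - F s y) \<le> integral {0..t'} (\<lambda>y. 1 - F s y)"
    using integral_diff_eq[OF complement_F_integrable True \<open>t \<le> t'\<close>] integral_complement_F_nonneg[of t t']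
    by simp
  then show ?thesis using \<delta>_pos by (simp add: V_def H_def)
qed (use V_nonpos_eq_0[of t] V_nonneg in auto)

text \<open>The shift telescopes: as \<open>V s\<close> is 0 left of 0, what remains is the integral
  of \<open>V s\<close> over the last stretch of length \<open>l\<close> before \<open>t\<close>,
  which is then reflected.\<close>

lemma integral_V_diff:
  assumes l: "0 < l"
  shows "(\<integral>y. indicator {0..t} y * (V s y - V s (y - l)) \<partial>lborel)
    = (\<integral>y. indicator {0..t} y * (V s (t - y) * indicator {..<l} y) \<partial>lborel)"
proof -
  have bnd: "\<bar>V s y\<bar> \<le> V s t" if "y \<le> t" for y
    using V_nonneg V_mono[OF that] by simp
  have i1: "integrable lborel (\<lambda>y. indicator {0..t} y * V s y)"
    by (rule bounded_borel_integrable_indicator[where B = "V s t"]) (use bnd in auto)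
  have i2: "integrable lborel (\<lambda>y. indicator {0..t} y * V s (y - l))"
    by (rule bounded_borel_integrable_indicator[where B = "V s t"]) (use bnd l in auto)
  have i3: "integrable lborel (\<lambda>y. indicator {0..t} y * (indicator {..t - l} y * V s y))"
    by (rule bounded_borel_integrable_indicator[where B = "V s t"]) (use bnd in \<open>auto simp: indicator_def V_nonneg\<close>)
  have "(\<integral>y. indicator {0..t} y * (V s y - V s (y - l)) \<partial>lborel)
      = (\<integral>y. indicator {0..t} y * V s y \<partial>lborel) - (\<integral>y. indicator {0..t} y * V s (y - l) \<partial>lborel)"
    using i1 i2 by (simp add: right_diff_distrib)
  also have "(\<integral>y. indicator {0..t} y * V s (y - l) \<partial>lborel) = (\<integral>y. indicator {-l..t - l} y * V s y \<partial>lborel)"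
    by (subst lborel_integral_real_affine[of 1 _ l])
      (auto simp: indicator_def intro!: Bochner_Integration.integral_cong)
  also have "\<dots> = (\<integral>y. indicator {0..t} y * (indicator {..t - l} y * V s y) \<partial>lborel)"
    using l by (intro Bochner_Integration.integral_cong) (auto simp: indicator_def V_nonpos_eq_0)
  also have "(\<integral>y. indicator {0..t} y * V s y \<partial>lborel) - \<dots>
      = (\<integral>y. indicator {0..t} y * (indicator {t - l<..} y * V s y) \<partial>lborel)"
    unfolding Bochner_Integration.integral_diff[OF i1 i3, symmetric]
    by (intro Bochner_Integration.integral_cong) (auto simp: indicator_def)
  also have "\<dots> = (\<integral>y. indicator {0..t} y * (V s (t - y) * indicator {..<l} y) \<partial>lborel)"
    by (subst lborel_integral_real_affine[of "-1" _ t])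
      (auto simp: indicator_def intro!: Bochner_Integration.integral_cong)
  finally show ?thesis .
qed

text \<open>\<open>H s - F s * H s\<close> is averaged over the life-length and integrated up to
  \<open>t\<close>. With the average outside, the inner integral telescopes for each fixed
  \<open>l\<close>; a second exchange produces the convolution with \<open>tail\<close>.\<close>

lemma V_renewal:
  assumes t: "0 \<le> t"
  shows "V s t = \<delta> * (\<integral>y. indicator {0..t} y * ((V s (t - y) + (1 - s)) * tail y) \<partial>lborel)"
proof -
  have bnd: "\<bar>V s y\<bar> \<le> V s t" if "y \<le> t" for y
    using V_nonneg V_mono[OF that] by simp
  have FH: "(1 - F s y) * H s y = (\<integral>l. (V s y - V s (y - l)) + (1 - s) * indicator {..<l} y \<partial>\<mu>)"
    if y: "0 \<le> y" for y
  proof -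
    have "AE l in \<mu>. \<bar>V s (y - l)\<bar> \<le> V s y"
      using life_pos by eventually_elim (simp add: V_nonneg V_mono)
    then have i: "integrable \<mu> (\<lambda>l. V s (y - l))"
      by (intro life.integrable_const_bound[where B = "V s y"]) auto
    have j: "integrable \<mu> (\<lambda>l. (1 - s) * indicator {..<l} y)"
      by (rule life.integrable_const_bound[where B = 1]) (use s in \<open>auto simp: indicator_def\<close>)
    \<comment> \<open>For \<open>y < l\<close> one has \<open>H s (y - l) = 1\<close>, so the factor
      \<open>s\<close> merely subtracts the constant \<open>1 - s\<close>. This makes the equation
      affine.\<close>
    have "(if y < l then s else 1) * H s (y - l) = 1 + V s (y - l) - (1 - s) * indicator {..<l} y" for l
      using V_nonpos_eq_0[of "y - l"] by (auto simp: V_def indicator_def)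
    then have "F s y * H s y = 1 + (\<integral>l. V s (y - l) \<partial>\<mu>) - (\<integral>l. (1 - s) * indicator {..<l} y \<partial>\<mu>)"
      using F_mult_H[OF s y] i j by (simp add: life.prob_space)
    moreover have "(\<integral>l. (V s y - V s (y - l)) + (1 - s) * indicator {..<l} y \<partial>\<mu>)
        = V s y - (\<integral>l. V s (y - l) \<partial>\<mu>) + (\<integral>l. (1 - s) * indicator {..<l} y \<partial>\<mu>)"
      using i j by (simp add: life.prob_space)
    ultimately show ?thesis by (simp add: V_def algebra_simps)
  qed
  have HV: "H s y = V s y + 1" for y by (simp add: V_def)
  have "V s t = \<delta> * integral {0..t} (\<lambda>y. (1 - F s y) * H s y)"
    unfolding V_def H_def
    by (subst integral_exp_const_mult[where B = 1]) (use t F_01[OF s] in auto)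
  also have "integral {0..t} (\<lambda>y. (1 - F s y) * H s y) = (\<integral>y. indicator {0..t} y * ((1 - F s y) * H s y) \<partial>lborel)"
  proof (rule bounded_borel_integral_eq)
    fix y assume "y \<in> {0..t}"
    then show "\<bar>(1 - F s y) * H s y\<bar> \<le> 1 * (V s t + 1)"
      unfolding abs_mult HV using F_01[OF s, of y] bnd[of y] V_nonneg by (intro mult_mono) auto
  qed (auto simp: HV)
  also have "\<dots> = (\<integral>y. indicator {0..t} y * (\<integral>l. (V s y - V s (y - l)) + (1 - s) * indicator {..<l} y \<partial>\<mu>) \<partial>lborel)"
    by (intro Bochner_Integration.integral_cong) (auto simp: FH indicator_def)
  \<comment> \<open>Negative \<open>l\<close> form a null set, but Fubini is applied with a bound
    valid for every \<open>l\<close>; \<open>max 0 l\<close> provides it.\<close>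
  also have "\<dots> = (\<integral>l. (\<integral>y. indicator {0..t} y * ((V s y - V s (y - max 0 l)) + (1 - s) * indicator {..<l} y) \<partial>lborel) \<partial>\<mu>)"
  proof -
    have "(\<integral>l. (V s y - V s (y - l)) + (1 - s) * indicator {..<l} y \<partial>\<mu>)
       = (\<integral>l. (V s y - V s (y - max 0 l)) + (1 - s) * indicator {..<l} y \<partial>\<mu>)" for y
      by (rule integral_cong_AE) (use life_pos in \<open>auto elim!: eventually_mono\<close>)
    moreover have "(\<integral>y. indicator {0..t} y * (\<integral>l. (V s y - V s (y - max 0 l)) + (1 - s) * indicator {..<l} y \<partial>\<mu>) \<partial>lborel)
      = (\<integral>l. (\<integral>y. indicator {0..t} y * ((V s y - V s (y - max 0 l)) + (1 - s) * indicator {..<l} y) \<partial>lborel) \<partial>\<mu>)"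
    proof (rule fubini_bounded)
      fix y l assume y: "y \<in> {0..t}"
      have "\<bar>V s y - V s (y - max 0 l)\<bar> \<le> V s t"
        using bnd[of y] V_mono[of "y - max 0 l" y] V_nonneg[of "y - max 0 l"] V_nonneg[of y] y by auto
      moreover have "\<bar>(1 - s) * indicator {..<l} y\<bar> \<le> 1"
        using s by (auto simp: indicator_def)
      ultimately show "\<bar>(V s y - V s (y - max 0 l)) + (1 - s) * indicator {..<l} y\<bar> \<le> V s t + 1"
        by linarith
    qed (simp add: case_prod_beta')
    ultimately show ?thesis by simp
  qed
  also have "\<dots> = (\<integral>l. (\<integral>y. indicator {0..t} y * ((V s (t - y) + (1 - s)) * indicator {..<l} y) \<partial>lborel) \<partial>\<mu>)"
  proof (rule integral_cong_AE)
    show "AE l in \<mu>. (\<integral>y. indicator {0..t} y * ((V s y - V s (y - max 0 l)) + (1 - s) * indicator {..<l} y) \<partial>lborel)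
      = (\<integral>y. indicator {0..t} y * ((V s (t - y) + (1 - s)) * indicator {..<l} y) \<partial>lborel)"
      using life_pos
    proof eventually_elim
      case (elim l)
      have i1: "integrable lborel (\<lambda>y. indicator {0..t} y * (V s y - V s (y - l)))"
      proof (rule bounded_borel_integrable_indicator)
        fix y assume "y \<in> {0..t}"
        then show "\<bar>V s y - V s (y - l)\<bar> \<le> V s t"
          using bnd[of y] V_mono[of "y - l" y] V_nonneg[of "y - l"] V_nonneg[of y] elim by auto
      qed measurable
      have i2: "integrable lborel (\<lambda>y. indicator {0..t} y * ((1 - s) * indicator {..<l} y))"
        by (rule bounded_borel_integrable_indicator[where B = 1]) (use s in \<open>auto simp: indicator_def\<close>)
      have i3: "integrable lborel (\<lambda>y. indicator {0..t} y * (V s (t - y) * indicator {..<l} y))"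
        by (rule bounded_borel_integrable_indicator[where B = "V s t"]) (use bnd V_nonneg in \<open>auto simp: indicator_def\<close>)
      have "(\<integral>y. indicator {0..t} y * ((V s y - V s (y - max 0 l)) + (1 - s) * indicator {..<l} y) \<partial>lborel)
        = (\<integral>y. indicator {0..t} y * (V s y - V s (y - l)) + indicator {0..t} y * ((1 - s) * indicator {..<l} y) \<partial>lborel)"
        using elim by (simp add: distrib_left max_def)
      also have "\<dots> = (\<integral>y. indicator {0..t} y * (V s (t - y) * indicator {..<l} y) + indicator {0..t} y * ((1 - s) * indicator {..<l} y) \<partial>lborel)"
        using i1 i2 i3 integral_V_diff[OF elim, of t] by simp
      finally show ?case by (simp add: algebra_simps)
    qed
    show "(\<lambda>l. \<integral>y. indicator {0..t} y * ((V s y - V s (y - max 0 l)) + (1 - s) * indicator {..<l} y) \<partial>lborel) \<in> borel_measurable \<mu>"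
      "(\<lambda>l. \<integral>y. indicator {0..t} y * ((V s (t - y) + (1 - s)) * indicator {..<l} y) \<partial>lborel) \<in> borel_measurable \<mu>"
      by measurable
  qed
  also have "\<dots> = (\<integral>y. indicator {0..t} y * (\<integral>l. (V s (t - y) + (1 - s)) * indicator {..<l} y \<partial>\<mu>) \<partial>lborel)"
  proof (rule fubini_bounded[symmetric])
    fix y l assume "y \<in> {0..t}"
    then show "\<bar>(V s (t - y) + (1 - s)) * indicator {..<l} y\<bar> \<le> V s t + 1"
      using bnd[of "t - y"] V_nonneg[of "t - y"] V_nonneg[of t] s by (auto simp: indicator_def)
  qed (simp add: case_prod_beta')
  finally show ?thesis by (simp add: tail_def)
qed

end

text \<open>The inhomogeneous part of the renewal equation is proportional to \<open>1 - s\<close>,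
  so the difference \<open>D\<close> solves the homogeneous equation. With
  \<open>tail \<le> 1\<close> this gives the inequality of \<open>gronwall_zero\<close>.\<close>

lemma V_linear:
  assumes s: "0 \<le> s" "s < 1" and t: "0 \<le> t"
  shows "V s t = (1 - s) * V 0 t"
proof -
  have s0: "(0::real) \<le> 0" "(0::real) < 1" by auto
  note [measurable] = measurable_V[OF s] measurable_V[OF s0]
  define D where "D t = V s t - (1 - s) * V 0 t" for t
  have [measurable]: "D \<in> borel_measurable borel" unfolding D_def by measurable
  have bnd: "\<bar>D y\<bar> \<le> V s t + V 0 t" if "y \<le> t" for y t
  proof -
    have "\<bar>(1 - s) * V 0 y\<bar> \<le> V 0 t"
      using s V_nonneg[OF s0, of y] V_mono[OF s0 that] mult_left_le_one_le[of "V 0 y" "1 - s"]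
      by (simp add: abs_mult)
    then show ?thesis
      using V_nonneg[OF s, of y] V_mono[OF s that] unfolding D_def by linarith
  qed
  have "D t = 0"
  proof (rule gronwall_zero[OF \<delta>_pos _ _ _ t])
    fix r assume r: "r \<in> {0..t}"
    have intV: "integrable lborel (\<lambda>y. indicator {0..r} y * ((V s' (r - y) + (1 - s')) * tail y))"
      if s': "0 \<le> s'" "s' < 1" for s'
    proof (rule bounded_borel_integrable_indicator)
      fix y assume "y \<in> {0..r}"
      then have "\<bar>V s' (r - y) + (1 - s')\<bar> * \<bar>tail y\<bar> \<le> (V s' r + 1) * 1"
        using V_nonneg[OF s', of "r - y"] V_mono[OF s', of "r - y" r] tail_01[of y] s'
        by (intro mult_mono) auto
      then show "\<bar>(V s' (r - y) + (1 - s')) * tail y\<bar> \<le> V s' r + 1" by (simp add: abs_mult)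
    qed (use measurable_V[OF s'] in measurable)
    have "D r = \<delta> * ((\<integral>y. indicator {0..r} y * ((V s (r - y) + (1 - s)) * tail y) \<partial>lborel)
        - (\<integral>y. (1 - s) * (indicator {0..r} y * ((V 0 (r - y) + (1 - 0)) * tail y)) \<partial>lborel))"
      unfolding D_def using V_renewal[OF s, of r] V_renewal[OF s0, of r] r
      by (simp add: right_diff_distrib)
    also have "\<dots> = \<delta> * (\<integral>y. indicator {0..r} y * (D (r - y) * tail y) \<partial>lborel)"
      unfolding Bochner_Integration.integral_diff[OF intV[OF s] integrable_mult_right[OF intV[OF s0]], symmetric]
      by (simp add: D_def algebra_simps)
    finally have "\<bar>D r\<bar> = \<delta> * \<bar>\<integral>y. indicator {0..r} y * (D (r - y) * tail y) \<partial>lborel\<bar>"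
      using \<delta>_pos by (simp add: abs_mult)
    also have "\<bar>\<integral>y. indicator {0..r} y * (D (r - y) * tail y) \<partial>lborel\<bar>
        \<le> (\<integral>y. \<bar>indicator {0..r} y * (D (r - y) * tail y)\<bar> \<partial>lborel)"
      by (rule integral_abs_bound)
    also have "\<dots> \<le> (\<integral>y. indicator {0..r} y * \<bar>D (r - y)\<bar> \<partial>lborel)"
    proof (rule integral_mono)
      have le: "\<bar>D (r - y) * tail y\<bar> \<le> \<bar>D (r - y)\<bar>" for y
        using tail_01[of y] by (simp add: abs_mult mult_left_le)
      show "integrable lborel (\<lambda>y. indicator {0..r} y * \<bar>D (r - y)\<bar>)"
        by (rule bounded_borel_integrable_indicator[where B = "V s r + V 0 r"]) (use bnd in auto)
      show "integrable lborel (\<lambda>y. \<bar>indicator {0..r} y * (D (r - y) * tail y)\<bar>)"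
        by (intro integrable_abs bounded_borel_integrable_indicator[where B = "V s r + V 0 r"]) (use order_trans[OF le bnd] in auto)
      show "\<bar>indicator {0..r} y * (D (r - y) * tail y)\<bar> \<le> indicator {0..r} y * \<bar>D (r - y)\<bar>" for y
        using le[of y] by (auto simp: indicator_def)
    qed
    also have "(\<integral>y. indicator {0..r} y * \<bar>D (r - y)\<bar> \<partial>lborel) = (\<integral>y. indicator {0..r} y * \<bar>D y\<bar> \<partial>lborel)"
      by (subst lborel_integral_real_affine[of "-1" _ r])
        (auto simp: indicator_def intro!: Bochner_Integration.integral_cong)
    also have "\<dots> = integral {0..r} (\<lambda>y. \<bar>D y\<bar>)"
      by (rule bounded_borel_integral_eq[symmetric, where B = "V s r + V 0 r"]) (use bnd in auto)
    finally show "\<bar>D r\<bar> \<le> \<delta> * integral {0..r} (\<lambda>y. \<bar>D y\<bar>)" using \<delta>_pos by simp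
  qed (use bnd in auto)
  then show ?thesis by (simp add: D_def)
qed

section \<open>Occupation times\<close>

text \<open>This is \<open>H 0\<close>. For \<open>t \<ge> 0\<close> its renewal equation identifies
  it as the scale function of the Levy process with drift -1 and jumps of law \<open>\<mu>\<close>
  at rate \<open>\<delta>\<close>: for large \<open>x\<close> its Laplace transform is \<open>1 / (x
  - \<delta> * \<integral> (1 - exp (- x * l)) \<mu>(dl))\<close>.\<close>

definition W :: "real \<Rightarrow> real" where
  "W t = V 0 t + 1"

lemma W_ge_1: "1 \<le> W t"
  using V_nonneg[of 0 t] by (simp add: W_def)

lemma W_mono: "t \<le> t' \<Longrightarrow> W t \<le> W t'"
  using V_mono[of 0 t t'] by (simp add: W_def)

lemma measurable_W [measurable]: "W \<in> borel_measurable borel"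
  unfolding W_def using measurable_V[of 0] by measurable

lemma W_renewal:
  assumes "0 \<le> t"
  shows "W t = 1 + \<delta> * (\<integral>y. indicator {0..t} y * (W (t - y) * tail y) \<partial>lborel)"
  using V_renewal[OF _ _ assms, of 0] by (simp add: W_def)

text \<open>Factoring \<open>W t\<close> out of \<open>s + (1 - s) * W t\<close> leaves a logarithm
  with a power series in \<open>s\<close> of ratio \<open>1 - 1 / W t\<close>, a number in
  \<open>[0, 1)\<close>.\<close>

lemma integral_complement_F:
  assumes s: "0 \<le> s" "s < 1" and t: "0 \<le> t"
  shows "\<delta> * integral {0..t} (\<lambda>y. 1 - F s y) = ln (W t) + ln (1 - s * (1 - 1 / W t))"
proof -
  have W: "1 \<le> W t" by (rule W_ge_1)
  have "0 \<le> 1 - 1 / W t" using W by simp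
  then have "s * (1 - 1 / W t) \<le> 1 * (1 - 1 / W t)"
    using s by (intro mult_right_mono) auto
  also have "\<dots> < 1" using W by simp
  finally have "0 < 1 - s * (1 - 1 / W t)" by simp
  moreover have "H s t = W t * (1 - s * (1 - 1 / W t))"
  proof -
    have "W t * (1 - s * (1 - 1 / W t)) = W t - s * W t + s"
      using W by (simp add: field_simps)
    then show ?thesis
      using V_linear[OF s t] by (simp add: V_def[of s] W_def algebra_simps)
  qed
  ultimately have "ln (H s t) = ln (W t) + ln (1 - s * (1 - 1 / W t))"
    using W by (simp add: ln_mult)
  then show ?thesis by (simp add: H_def)
qed

text \<open>Cut at a finite \<open>t\<close> because the power series also contains
  \<open>k = 0\<close>, whose total time is not finite in general.\<close>

definition occupation :: "nat \<Rightarrow> real \<Rightarrow> real" where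
  "occupation k t = (\<integral>u. indicator {0..t} u * P.prob {x. num_alive life gap u x = enat k} \<partial>lborel)"

lemma measurable_num_alive_P [measurable]:
  "Measurable.pred (borel \<Otimes>\<^sub>M P) (\<lambda>z. num_alive life gap (fst z) (snd z) = enat k)"
proof -
  have "sets (borel \<Otimes>\<^sub>M P) = sets (borel \<Otimes>\<^sub>M config_space)"
    using sets_P by (rule sets_pair_measure_cong[OF refl])
  then have "(\<lambda>z. num_alive life gap (fst z) (snd z)) \<in> measurable (borel \<Otimes>\<^sub>M P) (count_space UNIV)"
    using measurable_num_alive measurable_cong_sets by blast
  then show ?thesis by measurable
qed

lemma sets_num_alive: "{x. num_alive life gap u x = enat k} \<in> sets P"
proof -
  have "(\<lambda>x. (u, x)) \<in> measurable P (borel \<Otimes>\<^sub>M P)" by measurable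
  from measurable_compose[OF this measurable_num_alive_P[of k]]
  have "Measurable.pred P (\<lambda>x. num_alive life gap u x = enat k)" by simp
  from predE[OF this] show ?thesis by simp
qed

lemma measurable_prob_num_alive [measurable]:
  "(\<lambda>u. P.prob {x. num_alive life gap u x = enat k}) \<in> borel_measurable borel"
proof -
  have "(\<lambda>u. \<integral>x. (if num_alive life gap (fst (u, x)) (snd (u, x)) = enat k then 1 else 0 :: real) \<partial>P) \<in> borel_measurable borel"
    by measurable
  moreover have "(\<integral>x. (if num_alive life gap u x = enat k then 1 else 0 :: real) \<partial>P)
      = P.prob {x. num_alive life gap u x = enat k}" for u
  proof -
    have "(\<integral>x. (if num_alive life gap u x = enat k then 1 else 0 :: real) \<partial>P)
        = (\<integral>x. indicator {x. num_alive life gap u x = enat k} x \<partial>P)"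
      by (intro Bochner_Integration.integral_cong) (auto simp: indicator_def)
    then show ?thesis using sets_num_alive by simp
  qed
  ultimately show ?thesis by simp
qed

text \<open>Infinite populations have weight 0 and belong to none of the events, so both sides
  ignore them. Sum and integral are exchanged in \<open>ennreal\<close>, where nonnegativity
  suffices.\<close>

lemma F_sums:
  assumes s: "0 \<le> s" "s < 1"
  shows "(\<lambda>k. s ^ k * P.prob {x. num_alive life gap u x = enat k}) sums F s u"
proof -
  have "integrable P (\<lambda>x. weight s (pop u x))"
    by (rule P.integrable_const_bound[where B = 1]) (use weight_01[OF s] in auto)
  then have "ennreal (F s u) = (\<integral>\<^sup>+x. ennreal (weight s (pop u x)) \<partial>P)"
    unfolding F_def using weight_01[OF s] by (intro nn_integral_eq_integral[symmetric]) auto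
  also have "\<dots> = (\<integral>\<^sup>+x. (\<Sum>k. ennreal (s ^ k) * indicator {x. num_alive life gap u x = enat k} x) \<partial>P)"
  proof (rule nn_integral_cong)
    fix x
    have "indicator {x. num_alive life gap u x = enat k} x
        = (indicator {A. finite A \<and> card A = k} (pop u x) :: ennreal)" for k
      by (auto simp: indicator_def num_alive_def)
    then show "ennreal (weight s (pop u x)) = (\<Sum>k. ennreal (s ^ k) * indicator {x. num_alive life gap u x = enat k} x)"
      using weight_sums[OF s(1), of "pop u x"] by simp
  qed
  also have "\<dots> = (\<Sum>k. \<integral>\<^sup>+x. ennreal (s ^ k) * indicator {x. num_alive life gap u x = enat k} x \<partial>P)"
    by (intro nn_integral_suminf borel_measurable_times_ennreal borel_measurable_const
      borel_measurable_indicator sets_num_alive)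
  also have "\<dots> = (\<Sum>k. ennreal (s ^ k * P.prob {x. num_alive life gap u x = enat k}))"
    using sets_num_alive s by (simp add: nn_integral_cmult P.emeasure_eq_measure ennreal_mult)
  finally have "(\<lambda>k. ennreal (s ^ k * P.prob {x. num_alive life gap u x = enat k})) sums ennreal (F s u)"
    by (simp only: sums_iff summableI simp_thms)
  then show ?thesis
    using s F_01[OF s] by (subst (asm) sums_ennreal) auto
qed

lemma occupation_sums:
  assumes s: "0 \<le> s" "s < 1" and t: "0 \<le> t"
  shows "(\<lambda>k. s ^ k * occupation k t) sums integral {0..t} (F s)"
proof -
  let ?p = "\<lambda>k u. P.prob {x. num_alive life gap u x = enat k}"
  have p01: "0 \<le> ?p k u" "?p k u \<le> 1" for k u by auto
  have ip: "integrable lborel (\<lambda>u. indicator {0..t} u * ?p k u)" for k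
    by (rule bounded_borel_integrable_indicator[where B = 1]) auto
  have iF: "integrable lborel (\<lambda>u. indicator {0..t} u * F s u)"
    by (rule bounded_borel_integrable_indicator[where B = 1]) (use F_01[OF s] in auto)
  have "integral {0..t} (F s) = (\<integral>u. indicator {0..t} u * F s u \<partial>lborel)"
    by (rule bounded_borel_integral_eq[where B = 1]) (use F_01[OF s] in auto)
  then have "ennreal (integral {0..t} (F s)) = (\<integral>\<^sup>+u. ennreal (indicator {0..t} u * F s u) \<partial>lborel)"
    using iF F_01[OF s] by (simp add: nn_integral_eq_integral)
  also have "\<dots> = (\<integral>\<^sup>+u. (\<Sum>k. ennreal (s ^ k * (indicator {0..t} u * ?p k u))) \<partial>lborel)"
  proof (rule nn_integral_cong)
    fix u
    have "(\<lambda>k. s ^ k * (indicator {0..t} u * ?p k u)) sums (indicator {0..t} u * F s u)"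
      using sums_mult[OF F_sums[OF s, of u], of "indicator {0..t} u"] by (simp add: mult_ac)
    then show "ennreal (indicator {0..t} u * F s u)
        = (\<Sum>k. ennreal (s ^ k * (indicator {0..t} u * ?p k u)))"
      by (intro suminf_ennreal_eq[symmetric] mult_nonneg_nonneg zero_le_power s)
        (auto simp: measure_nonneg)
  qed
  also have "\<dots> = (\<Sum>k. \<integral>\<^sup>+u. ennreal (s ^ k * (indicator {0..t} u * ?p k u)) \<partial>lborel)"
    by (rule nn_integral_suminf) measurable
  also have "\<dots> = (\<Sum>k. ennreal (s ^ k * occupation k t))"
  proof (rule suminf_cong)
    fix k
    show "(\<integral>\<^sup>+u. ennreal (s ^ k * (indicator {0..t} u * ?p k u)) \<partial>lborel) = ennreal (s ^ k * occupation k t)"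
      using nn_integral_eq_integral[OF integrable_mult_right[OF ip[of k], of "s ^ k"]] s
      by (simp add: occupation_def)
  qed
  finally have "(\<lambda>k. ennreal (s ^ k * occupation k t)) sums ennreal (integral {0..t} (F s))"
    by (simp only: sums_iff summableI simp_thms)
  moreover have "0 \<le> occupation k t" for k
    unfolding occupation_def by (intro integral_nonneg_AE AE_I2) simp
  moreover have "0 \<le> integral {0..t} (F s)"
    by (intro integral_nonneg bounded_borel_integrable_on[where B = 1]) (use F_01[OF s] in auto)
  ultimately show ?thesis
    using s by (subst (asm) sums_ennreal) auto
qed

lemma occupation_eq:
  assumes t: "0 \<le> t" and k: "1 \<le> k"
  shows "occupation k t = (1 - 1 / W t) ^ k / (\<delta> * real k)"
proof -
  define q where "q = 1 - 1 / W t"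
  have q: "0 \<le> q" "q < 1" using W_ge_1[of t] by (auto simp: q_def)
  \<comment> \<open>For \<open>n = 0\<close> the quotient \<open>q ^ n / real n\<close> is 0 by the
    convention for division by 0, matching the missing constant term of the logarithm series; the
    last summand corrects the coefficient of \<open>s ^ 0\<close>.\<close>
  define d where "d n = \<delta> * occupation n t - q ^ n / real n - (if n = 0 then \<delta> * t - ln (W t) else 0)" for n
  have "d k = 0"
  proof (rule powser_coeffs_zero)
    fix s :: real assume "0 < s" "s < 1"
    then have s: "0 \<le> s" "s < 1" by auto
    have "\<delta> * integral {0..t} (F s) = \<delta> * t - ln (W t) - ln (1 - s * q)"
    proof -
      have J: "integral {0..t} (\<lambda>y. 1 - F s y) = t - integral {0..t} (F s)"
        using t by (subst Henstock_Kurzweil_Integration.integral_diff)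
          (auto intro!: bounded_borel_integrable_on[where B = 1] simp: F_01[OF s])
      then show ?thesis
        using integral_complement_F[OF s t, folded q_def] unfolding J right_diff_distrib by linarith
    qed
    moreover have "(\<lambda>n. - ((s * q) ^ n) / real n) sums ln (1 - s * q)"
    proof -
      have "s * q < 1" using mult_left_le_one_le[of q s] s q by linarith
      then show ?thesis using ln_series'[of "- (s * q)"] s q by (simp add: abs_mult)
    qed
    moreover have "(\<lambda>n. \<delta> * (s ^ n * occupation n t)) sums (\<delta> * integral {0..t} (F s))"
      by (intro sums_mult occupation_sums[OF s t])
    moreover have "(\<lambda>n. if n = 0 then \<delta> * t - ln (W t) else 0) sums (\<delta> * t - ln (W t))"
      using sums_single[of 0 "\<lambda>_. \<delta> * t - ln (W t)"] by simp
    ultimately have "(\<lambda>n. \<delta> * (s ^ n * occupation n t) + (- ((s * q) ^ n) / real n)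
        - (if n = 0 then \<delta> * t - ln (W t) else 0)) sums 0"
      using sums_diff[OF sums_add] by fastforce
    moreover have "\<delta> * (s ^ n * occupation n t) + (- ((s * q) ^ n) / real n)
        - (if n = 0 then \<delta> * t - ln (W t) else 0) = d n * s ^ n" for n
      by (auto simp: d_def algebra_simps power_mult_distrib)
    ultimately show "(\<lambda>n. d n * s ^ n) sums 0" by simp
  qed
  then show ?thesis
    using k \<delta>_pos by (simp add: d_def q_def field_simps)
qed

end

locale tree_law_mean_one = tree_law +
  assumes integrable_life: "integrable \<mu> (\<lambda>l. l)" and mean_one: "(\<integral>l. l \<partial>\<mu>) = 1"
begin

text \<open>Layer-cake formula: by Fubini the integral of \<open>tail\<close> up to \<open>n\<close>
  is the mean of the life-length cut at \<open>n\<close>, which converges to the full mean.\<close>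

lemma integral_tail_tendsto: "(\<lambda>n. \<integral>y. indicator {0..real n} y * tail y \<partial>lborel) \<longlonglongrightarrow> 1"
proof -
  have eq: "(\<integral>y. indicator {0..real n} y * tail y \<partial>lborel) = (\<integral>l. min \<bar>l\<bar> (real n) \<partial>\<mu>)" for n
  proof -
    have "(\<integral>y. indicator {0..real n} y * tail y \<partial>lborel)
        = (\<integral>l. (\<integral>y. indicator {0..real n} y * indicator {..<l} y \<partial>lborel) \<partial>\<mu>)"
      unfolding tail_def by (rule fubini_bounded[where B = 1]) (auto simp: case_prod_beta' indicator_def)
    also have "\<dots> = (\<integral>l. min \<bar>l\<bar> (real n) \<partial>\<mu>)"
    proof (rule integral_cong_AE)
      show "AE l in \<mu>. (\<integral>y. indicator {0..real n} y * indicator {..<l} y \<partial>lborel) = min \<bar>l\<bar> (real n)"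
        using life_pos
      proof eventually_elim
        case (elim l)
        have "(\<integral>y. indicator {0..real n} y * indicator {..<l} y \<partial>lborel)
            = (\<integral>y. indicat_real (if l \<le> real n then {0..<l} else {0..real n}) y \<partial>lborel)"
          by (intro Bochner_Integration.integral_cong) (auto simp: indicator_def)
        also have "\<dots> = min \<bar>l\<bar> (real n)"
          using elim by (cases "l \<le> real n") simp_all
        finally show ?case .
      qed
    qed measurable
    finally show ?thesis .
  qed
  have "(\<lambda>n. \<integral>l. min \<bar>l\<bar> (real n) \<partial>\<mu>) \<longlonglongrightarrow> (\<integral>l. \<bar>l\<bar> \<partial>\<mu>)"
  proof (rule integral_dominated_convergence[where w = "\<lambda>l. \<bar>l\<bar>"])
    show "AE l in \<mu>. (\<lambda>n. min \<bar>l\<bar> (real n)) \<longlonglongrightarrow> \<bar>l\<bar>"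
    proof (intro AE_I2 tendsto_eventually)
      fix l :: real
      obtain N where N: "\<bar>l\<bar> \<le> real N" using real_arch_simple by blast
      show "eventually (\<lambda>n. min \<bar>l\<bar> (real n) = \<bar>l\<bar>) sequentially"
        by (rule eventually_sequentiallyI[of N]) (use N in linarith)
    qed
    show "integrable \<mu> (\<lambda>l. \<bar>l\<bar>)"
      using integrable_life by (rule integrable_abs)
    show "AE l in \<mu>. norm (min \<bar>l\<bar> (real n)) \<le> \<bar>l\<bar>" for n
      by (intro AE_I2) simp
  qed measurable
  also have "(\<integral>l. \<bar>l\<bar> \<partial>\<mu>) = (\<integral>l. l \<partial>\<mu>)"
  proof (rule integral_cong_AE)
    show "AE l in \<mu>. \<bar>l\<bar> = l" using life_pos by eventually_elim simp
  qed measurable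
  finally show ?thesis by (simp add: eq mean_one)
qed

text \<open>In the renewal equation \<open>W (t - y) \<le> W t\<close>, and \<open>tail\<close> has
  mass at most 1, whence \<open>W t \<le> 1 + \<delta> * W t\<close>. For
  \<open>\<delta> < 1\<close> this keeps \<open>W\<close> bounded.\<close>

lemma W_le: "(1 - \<delta>) * W t \<le> 1"
proof (cases "0 \<le> t")
  case True
  have i: "integrable lborel (\<lambda>y. indicator {0..t} y * tail y)" for t
    by (rule bounded_borel_integrable_indicator[where B = 1]) (use tail_01 in auto)
  have W0: "0 \<le> W y" for y using W_ge_1[of y] by linarith
  have le_1: "(\<integral>y. indicator {0..t} y * tail y \<partial>lborel) \<le> 1"
  proof -
    obtain N where N: "t \<le> real N" using real_arch_simple by blast
    have "(\<integral>y. indicator {0..t} y * tail y \<partial>lborel) \<le> (\<integral>y. indicator {0..real n} y * tail y \<partial>lborel)"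
      if "N \<le> n" for n
      using N that tail_01 by (intro integral_mono i) (auto simp: indicator_def)
    then show ?thesis
      by (intro LIMSEQ_le_const[OF integral_tail_tendsto]) auto
  qed
  have "(\<integral>y. indicator {0..t} y * (W (t - y) * tail y) \<partial>lborel) \<le> (\<integral>y. W t * (indicator {0..t} y * tail y) \<partial>lborel)"
  proof (rule integral_mono)
    have le: "W (t - y) * tail y \<le> W t * tail y" if "0 \<le> y" for y
      using W_mono[of "t - y" t] that tail_01[of y] by (intro mult_right_mono) auto
    show "indicator {0..t} y * (W (t - y) * tail y) \<le> W t * (indicator {0..t} y * tail y)" for y
      using le[of y] by (auto simp: indicator_def)
    show "integrable lborel (\<lambda>y. indicator {0..t} y * (W (t - y) * tail y))"
    proof (rule bounded_borel_integrable_indicator)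
      fix y assume "y \<in> {0..t}"
      then show "\<bar>W (t - y) * tail y\<bar> \<le> W t * 1"
        unfolding abs_mult using W_mono[of "t - y" t] W0[of "t - y"] tail_01[of y]
        by (intro mult_mono) auto
    qed measurable
  qed (use i in auto)
  also have "\<dots> = W t * (\<integral>y. indicator {0..t} y * tail y \<partial>lborel)"
    by simp
  also have "\<dots> \<le> W t * 1"
    using le_1 W0 by (rule mult_left_mono)
  finally have "\<delta> * (\<integral>y. indicator {0..t} y * (W (t - y) * tail y) \<partial>lborel) \<le> \<delta> * (W t * 1)"
    using \<delta>_pos by simp
  then have "W t \<le> 1 + \<delta> * (W t * 1)"
    using W_renewal[OF True] by linarith
  then show ?thesis by (simp add: algebra_simps)
next
  case False
  then have "W t = 1" using V_nonpos_eq_0[of 0 t] by (simp add: W_def)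
  then show ?thesis using \<delta>_pos by simp
qed

text \<open>Lower counterpart of \<open>W_le\<close>: at time \<open>t + t\<close> the convolution
  is restricted to \<open>y \<le> t\<close>, where \<open>W (t + t - y) \<ge> W t\<close>.\<close>

lemma W_double_ge:
  assumes t: "0 \<le> t"
  shows "1 + \<delta> * (W t * (\<integral>y. indicator {0..t} y * tail y \<partial>lborel)) \<le> W (t + t)"
proof -
  have W0: "0 \<le> W y" for y using W_ge_1[of y] by linarith
  have i: "integrable lborel (\<lambda>y. indicator {0..t} y * tail y)" for t
    by (rule bounded_borel_integrable_indicator[where B = 1]) (use tail_01 in auto)
  have "(\<integral>y. W t * (indicator {0..t} y * tail y) \<partial>lborel)
      \<le> (\<integral>y. indicator {0..t + t} y * (W (t + t - y) * tail y) \<partial>lborel)"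
  proof (rule integral_mono)
    have le: "W t * tail y \<le> W (t + t - y) * tail y" if "y \<le> t" for y
      using W_mono[of t "t + t - y"] that tail_01[of y] by (intro mult_right_mono) auto
    show "W t * (indicator {0..t} y * tail y) \<le> indicator {0..t + t} y * (W (t + t - y) * tail y)" for y
      using le[of y] t W0 tail_01[of y] by (auto simp: indicator_def)
    show "integrable lborel (\<lambda>y. indicator {0..t + t} y * (W (t + t - y) * tail y))"
    proof (rule bounded_borel_integrable_indicator)
      fix y assume "y \<in> {0..t + t}"
      then show "\<bar>W (t + t - y) * tail y\<bar> \<le> W (t + t) * 1"
        unfolding abs_mult using W_mono[of "t + t - y" "t + t"] W0[of "t + t - y"] tail_01[of y]
        by (intro mult_mono) auto
    qed measurable
  qed (use i in auto)
  then have "\<delta> * (W t * (\<integral>y. indicator {0..t} y * tail y \<partial>lborel))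
      \<le> \<delta> * (\<integral>y. indicator {0..t + t} y * (W (t + t - y) * tail y) \<partial>lborel)"
    using \<delta>_pos by simp
  then show ?thesis using W_renewal[of "t + t"] t by simp
qed

text \<open>\<open>r = 1 / W\<close> decreases to some \<open>\<rho> \<ge> 0\<close>, and
  \<open>W_le\<close> gives \<open>\<rho> \<ge> 1 - \<delta>\<close>. The doubling inequality
  becomes \<open>\<rho> * (\<rho> + \<delta> - 1) \<le> 0\<close> in the limit, so one of the two
  nonnegative factors is 0 and \<open>\<rho> = max 0 (1 - \<delta>)\<close>.\<close>

lemma W_limit: "(\<lambda>n. 1 - 1 / W (real n)) \<longlonglongrightarrow> min 1 \<delta>"
proof -
  define r where "r n = 1 / W (real n)" for n
  have W0: "0 < W y" for y using W_ge_1[of y] by linarith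
  have r01: "0 < r n" "r n \<le> 1" for n using W0 W_ge_1 by (auto simp: r_def)
  have r_ge: "1 - \<delta> \<le> r n" for n
    using W_le[of "real n"] W0[of "real n"] by (simp add: r_def pos_le_divide_eq)
  have "decseq r"
    unfolding decseq_def r_def using W0 by (auto intro!: divide_left_mono W_mono)
  then obtain \<rho> where \<rho>: "r \<longlonglongrightarrow> \<rho>"
    using decseq_convergent[of r 0] r01 by (metis less_imp_le)
  have \<rho>0: "0 \<le> \<rho>"
    by (rule LIMSEQ_le_const[OF \<rho>]) (use r01 less_imp_le in blast)
  have \<rho>\<delta>: "1 - \<delta> \<le> \<rho>"
    by (rule LIMSEQ_le_const[OF \<rho>]) (use r_ge in blast)
  let ?m = "\<lambda>n. \<integral>y. indicator {0..real n} y * tail y \<partial>lborel"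
  \<comment> \<open>This is the doubling inequality multiplied by
    \<open>r n * r (n + n)\<close>.\<close>
  have ineq: "r (n + n) * r n + \<delta> * ?m n * r (n + n) \<le> r n" for n
  proof -
    have "1 + \<delta> * (W (real n) * ?m n) \<le> W (real n + real n)"
      by (rule W_double_ge) simp
    then have "(1 + \<delta> * (W (real n) * ?m n)) * (r n * r (n + n)) \<le> W (real (n + n)) * (r n * r (n + n))"
      using r01 by (intro mult_right_mono) (auto intro: less_imp_le)
    moreover have "W (real (n + n)) * (r n * r (n + n)) = r n"
      using W0[of "real (n + n)"] by (simp add: r_def)
    moreover have "(1 + \<delta> * (W (real n) * ?m n)) * (r n * r (n + n)) = r (n + n) * r n + \<delta> * ?m n * r (n + n)"
    proof -
      have "(1 + \<delta> * (w * m)) * ((1 / w) * x) = x * (1 / w) + \<delta> * m * x" if "0 < w" for w m x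
        using that by (simp add: field_simps)
      from this[OF W0] show ?thesis unfolding r_def .
    qed
    ultimately show ?thesis by (simp only:)
  qed
  have \<rho>2: "(\<lambda>n. r (n + n)) \<longlonglongrightarrow> \<rho>"
    using LIMSEQ_subseq_LIMSEQ[OF \<rho>, of "\<lambda>n. n + n"] by (auto simp: strict_mono_def comp_def)
  have "(\<lambda>n. r (n + n) * r n + \<delta> * ?m n * r (n + n)) \<longlonglongrightarrow> \<rho> * \<rho> + \<delta> * 1 * \<rho>"
    by (intro tendsto_add tendsto_mult tendsto_const \<rho> \<rho>2 integral_tail_tendsto)
  then have "\<rho> * \<rho> + \<delta> * 1 * \<rho> \<le> \<rho>"
    by (rule LIMSEQ_le[OF _ \<rho>]) (use ineq in blast)
  then have "\<rho> * (\<rho> + \<delta> - 1) \<le> 0" by (simp add: algebra_simps)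
  then have "\<rho> = 0 \<or> \<rho> + \<delta> = 1"
    using mult_pos_pos[of \<rho> "\<rho> + \<delta> - 1"] \<rho>0 \<rho>\<delta> by linarith
  then have "1 - \<rho> = min 1 \<delta>"
    using \<rho>0 \<rho>\<delta> by auto
  moreover have "(\<lambda>n. 1 - r n) \<longlonglongrightarrow> 1 - \<rho>"
    by (intro tendsto_intros \<rho>)
  ultimately show ?thesis by (simp add: r_def)
qed

text \<open>Monotone convergence along integer horizons, applied to \<open>occupation_eq\<close> and
  \<open>W_limit\<close>.\<close>

lemma total_occupation:
  assumes k: "1 \<le> k"
  shows "(\<integral>\<^sup>+u\<in>{0..}. ennreal (P.prob {x. num_alive life gap u x = enat k}) \<partial>lborel)
    = ennreal (\<delta> ^ (k - 1) / (real k * max 1 \<delta> ^ k))"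
proof -
  let ?p = "\<lambda>u. P.prob {x. num_alive life gap u x = enat k}"
  have "(\<lambda>n. \<integral>\<^sup>+u. ennreal (indicator {0..real n} u * ?p u) \<partial>lborel)
      \<longlonglongrightarrow> (\<integral>\<^sup>+u. ennreal (?p u) * indicator {0..} u \<partial>lborel)"
  proof (rule nn_integral_LIMSEQ)
    show "incseq (\<lambda>n u. ennreal (indicator {0..real n} u * ?p u))"
      by (auto simp: incseq_def le_fun_def indicator_def intro!: ennreal_leI)
    fix u :: real
    obtain N where N: "u \<le> real N" using real_arch_simple by blast
    have "ennreal (indicator {0..real n} u * ?p u) = ennreal (?p u) * indicator {0..} u" if "N \<le> n" for n
      using N that by (auto simp: indicator_def)
    then show "(\<lambda>n. ennreal (indicator {0..real n} u * ?p u)) \<longlonglongrightarrow> ennreal (?p u) * indicator {0..} u"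
      by (intro tendsto_eventually eventually_sequentiallyI[of N])
  qed measurable
  moreover have "(\<integral>\<^sup>+u. ennreal (indicator {0..real n} u * ?p u) \<partial>lborel) = ennreal (occupation k (real n))" for n
    unfolding occupation_def
    by (intro nn_integral_eq_integral bounded_borel_integrable_indicator[where B = 1]) auto
  moreover have "(\<lambda>n. ennreal (occupation k (real n))) \<longlonglongrightarrow> ennreal ((min 1 \<delta>) ^ k / (\<delta> * real k))"
    unfolding occupation_eq[OF of_nat_0_le_iff k] using \<delta>_pos k
    by (intro tendsto_ennrealI tendsto_divide tendsto_power tendsto_const W_limit) auto
  ultimately have "(\<integral>\<^sup>+u. ennreal (?p u) * indicator {0..} u \<partial>lborel) = ennreal ((min 1 \<delta>) ^ k / (\<delta> * real k))"
    by (auto intro: LIMSEQ_unique)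
  then show ?thesis
    by (simp add: min_one_divide[OF \<delta>_pos k])
qed

end

section \<open>Splitting trees on arbitrary probability spaces\<close>

context splitting_tree
begin

text \<open>Transports the given tree to the canonical space, where all probabilities are
  computed.\<close>

definition config :: "'a \<Rightarrow> config" where
  "config \<omega> = (\<lambda>i. case i of Inl v \<Rightarrow> L v \<omega> | Inr (v, k) \<Rightarrow> G v k \<omega>)"

lemma num_alive_config: "num_alive L G u \<omega> = num_alive life gap u (config \<omega>)"
proof -
  have p: "birth_point G v k \<omega> = birth_point gap v k (config \<omega>)" for v k
    by (simp add: birth_point_def config_def)
  have b: "born L G v \<omega> \<longleftrightarrow> born life gap v (config \<omega>)" for v
    by (induction v) (auto simp: p, auto simp: config_def)
  have t: "birth_time G v \<omega> = birth_time gap v (config \<omega>)" for v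
    by (induction v) (auto simp: p)
  show ?thesis
    by (simp add: num_alive_def alive_def b t) (simp add: config_def)
qed

lemma config_coordinate:
  "(\<lambda>\<omega>. config \<omega> i) = (case i of Inl v \<Rightarrow> L v | Inr (v, k) \<Rightarrow> G v k)"
  by (auto simp: config_def split: sum.split)

lemma measurable_config [measurable]: "config \<in> measurable M config_space"
proof (rule measurable_PiM_single')
  fix i :: "individual + individual \<times> nat"
  have "random_variable borel (case i of Inl v \<Rightarrow> L v | Inr (v, k) \<Rightarrow> G v k)"
    using independent unfolding indep_vars_def by blast
  then show "(\<lambda>\<omega>. config \<omega> i) \<in> borel_measurable M"
    by (simp only: config_coordinate)
qed auto

text \<open>Independence makes the joint law the product of the marginals, and the marginals are
  those of \<open>law\<close>.\<close>

lemma distr_config: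
  assumes "tree_law \<mu> \<delta>"
  shows "distr M config_space config = tree_law.P \<mu> \<delta>"
proof -
  interpret tree_law \<mu> \<delta> by fact
  let ?X = "\<lambda>i. case i of Inl v \<Rightarrow> L v | Inr (v, k) \<Rightarrow> G v k"
  have rv: "random_variable borel (?X i)" for i
    using independent unfolding indep_vars_def by blast
  have "distr M config_space (\<lambda>\<omega>. \<lambda>i\<in>UNIV. ?X i \<omega>) = (\<Pi>\<^sub>M i\<in>UNIV. distr M borel (?X i))"
    using independent by (subst (asm) indep_vars_iff_distr_eq_PiM) (auto intro: rv)
  moreover have "(\<lambda>\<omega>. \<lambda>i\<in>UNIV. ?X i \<omega>) = config"
    using config_coordinate by (auto simp: restrict_UNIV fun_eq_iff)
  moreover have "distr M borel (?X i) = law i" for i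
  proof (cases i)
    case (Inr p)
    then show ?thesis
      using distributed_distr_eq_density[OF gap_law[of "fst p" "snd p"]]
      by (cases p) (simp add: law_def cong: distr_cong)
  qed (simp add: law_def life_law)
  ultimately show ?thesis by (simp add: P_def)
qed

end

theorem theorem1p1:
  fixes \<delta> :: real and N :: "'b measure" and Q :: "'b \<Rightarrow> real"
    and M :: "'a measure" and L :: "individual \<Rightarrow> 'a \<Rightarrow> real"
    and G :: "individual \<Rightarrow> nat \<Rightarrow> 'a \<Rightarrow> real" and K :: nat
  assumes "\<delta> > 0"
    and "prob_space N" and "Q \<in> borel_measurable N"
    and "AE x in N. Q x > 0" and "integrable N Q" and "(\<integral>x. Q x \<partial>N) = 1"
    and "splitting_tree M (distr N borel Q) \<delta> L G"
    and "K \<ge> 1"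
  shows "(\<integral>\<^sup>+\<omega>. time_at L G K \<omega> \<partial>M)
           = (\<integral>\<^sup>+u\<in>{0..}. ennreal (measure M {\<omega> \<in> space M. num_alive L G u \<omega> = enat K}) \<partial>lborel)
       \<and> (\<integral>\<^sup>+u\<in>{0..}. ennreal (measure M {\<omega> \<in> space M. num_alive L G u \<omega> = enat K}) \<partial>lborel)
           = ennreal (\<delta> ^ (K - 1) / (real K * max 1 \<delta> ^ K))"
proof -
  interpret N: prob_space N by fact
  interpret splitting_tree M "distr N borel Q" \<delta> L G by fact
  note [measurable] = \<open>Q \<in> borel_measurable N\<close>
  interpret T: tree_law_mean_one "distr N borel Q" \<delta>
  proof (intro tree_law_mean_one.intro tree_law.intro tree_law_mean_one_axioms.intro)
    show "prob_space (distr N borel Q)" by (rule N.prob_space_distr) measurable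
    show "AE l in distr N borel Q. 0 < l" using assms(4) by (subst AE_distr_iff) auto
    show "integrable (distr N borel Q) (\<lambda>l. l)" using assms(5) by (subst integrable_distr_eq) auto
    show "(\<integral>l. l \<partial>distr N borel Q) = 1" using assms(6) by (subst integral_distr) auto
  qed (use assms(1) in auto)
  have P_eq: "T.P = distr M config_space config"
    using distr_config[OF T.tree_law_axioms] by simp
  let ?A = "\<lambda>u. {\<omega> \<in> space M. num_alive L G u \<omega> = enat K}"
  have prob_eq: "measure M (?A u) = T.P.prob {x. num_alive life gap u x = enat K}" for u
    unfolding P_eq
  proof (subst measure_distr)
    show "{x. num_alive life gap u x = enat K} \<in> sets config_space"
      using T.sets_num_alive[of u K] T.sets_P by simp
    show "measure M (?A u) = measure M (config -` {x. num_alive life gap u x = enat K} \<inter> space M)"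
      by (rule arg_cong[where f = "measure M"]) (auto simp: num_alive_config)
  qed measurable
  \<comment> \<open>Joint measurability in \<open>\<omega>\<close> and \<open>u\<close>, as Tonelli
    requires, is inherited from the canonical space.\<close>
  have pred: "Measurable.pred (M \<Otimes>\<^sub>M lborel) (\<lambda>(\<omega>, u). num_alive L G u \<omega> = enat K)"
  proof -
    have "(\<lambda>p. (snd p, config (fst p))) \<in> measurable (M \<Otimes>\<^sub>M lborel) (borel \<Otimes>\<^sub>M config_space)"
      by measurable
    from measurable_compose[OF this measurable_num_alive]
    have "(\<lambda>p. num_alive L G (snd p) (fst p)) \<in> measurable (M \<Otimes>\<^sub>M lborel) (count_space UNIV)"
      by (simp add: num_alive_config)
    then show ?thesis by (simp add: case_prod_beta')
  qed
  interpret Ml: pair_sigma_finite M lborel ..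
  have "(\<integral>\<^sup>+\<omega>. time_at L G K \<omega> \<partial>M)
      = (\<integral>\<^sup>+\<omega>. \<integral>\<^sup>+u. (if num_alive L G u \<omega> = enat K then 1 else 0) * indicator {0..} u \<partial>lborel \<partial>M)"
    unfolding time_at_def by (intro nn_integral_cong) (auto simp: indicator_def)
  also have "\<dots> = (\<integral>\<^sup>+u. \<integral>\<^sup>+\<omega>. (if num_alive L G u \<omega> = enat K then 1 else 0) * indicator {0..} u \<partial>M \<partial>lborel)"
    using pred by (intro Ml.Fubini'[symmetric]) (simp add: case_prod_beta')
  also have "\<dots> = (\<integral>\<^sup>+u\<in>{0..}. ennreal (measure M (?A u)) \<partial>lborel)"
  proof (rule nn_integral_cong)
    fix u :: real
    have A: "?A u \<in> sets M"
    proof -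
      have "config -` {x. num_alive life gap u x = enat K} \<inter> space M \<in> sets M"
        using T.sets_num_alive[of u K] T.sets_P by (intro measurable_sets[OF measurable_config]) simp
      then show ?thesis by (simp add: num_alive_config vimage_def Int_def conj_commute)
    qed
    have "(\<integral>\<^sup>+\<omega>. (if num_alive L G u \<omega> = enat K then 1 else 0) * indicator {0..} u \<partial>M)
        = (\<integral>\<^sup>+\<omega>. indicator {0..} u * indicator (?A u) \<omega> \<partial>M)"
      by (intro nn_integral_cong) (auto simp: indicator_def)
    also have "\<dots> = ennreal (measure M (?A u)) * indicator {0..} u"
      using A by (simp add: nn_integral_cmult_indicator emeasure_eq_measure mult.commute)
    finally show "(\<integral>\<^sup>+\<omega>. (if num_alive L G u \<omega> = enat K then 1 else 0) * indicator {0..} u \<partial>M)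
        = ennreal (measure M (?A u)) * indicator {0..} u" .
  qed
  finally show ?thesis
    using T.total_occupation[OF \<open>K \<ge> 1\<close>] by (simp add: prob_eq)
qed

end
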